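(* Let $\alpha\in(1,2)$ and $\rho\in(0,1)$ with $\alpha\rho,\alpha\hat\rho\in(0,1)$, where $\hat\rho=1-\rho$. Let $\tilde\xi$ be a Lévy process with characteristic exponent \[ \tilde\Psi(z)=\frac{\Gamma(\alpha\rho-iz)}{\Gamma(-iz)}\frac{\Gamma(1-\alpha\rho+iz)}{\Gamma(1-\alpha+iz)},\qquad z\in\mathbb{R}, \] issued from $0$, and let $\tilde u$ be the density of its potential measure, $\int_0^\infty\mathbf{P}(\tilde\xi_t\in dx)dt=\tilde u(x)dx$. Then for $x>0$, \[ \tilde u(x)=-\frac1\pi\Gamma(1-\alpha)\sin(\pi\alpha\rho)\big[1-(1-e^{-x})^{\alpha-1}\big]-\frac1\pi\Gamma(1-\alpha)\sin(\pi\alpha\hat\rho)e^{-(\alpha-1)x}, \] for $x<0$, \[ \tilde u(x)=-\frac1\pi\Gamma(1-\alpha)\sin(\pi\alpha\rho)-\frac1\pi\Gamma(1-\alpha)\sin(\pi\alpha\hat\rho)\big[1-(1-e^{x})^{\alpha-1}\big]e^{-(\alpha-1)x}, \] and in particular $\tilde u(0)=-\frac1\pi\Gamma(1-\alpha)\big(\sin(\pi\alpha\rho)+\sin(\pi\alpha\hat\rho)\big)$.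
   Context: The characteristic exponent $\Psi$ of a Lévy process $Y$ is defined by $\mathbf{E}[e^{izY_t}]=e^{-t\Psi(z)}$. The process $\tilde\xi$ is the Lévy process underlying, via the Lamperti transform, the censored stable process obtained from a one-dimensional stable process with index $\alpha$ and positivity parameter $\rho=\mathbb{P}(X_1\ge0)$ by erasing its excursions below $0$ and absorbing at $0$; for $\alpha\in(1,2)$ it drifts to $-\infty$, so its potential measure is locally finite. *)

theory Defs
  imports "HOL-Probability.Probability"
begin

definition levy_process :: "'a measure \<Rightarrow> (real \<Rightarrow> 'a \<Rightarrow> real) \<Rightarrow> bool" where
  "levy_process M X \<longleftrightarrow>
     prob_space M \<and>
     (\<forall>t. X t \<in> borel_measurable M) \<and>
     (AE \<omega> in M. X 0 \<omega> = 0) \<and>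
     (\<forall>(n::nat) (ts::nat \<Rightarrow> real). 0 \<le> ts 0 \<and> (\<forall>i<n. ts i \<le> ts (Suc i)) \<longrightarrow>
        prob_space.indep_vars M (\<lambda>_. borel) (\<lambda>i \<omega>. X (ts (Suc i)) \<omega> - X (ts i) \<omega>) {..<n}) \<and>
     (\<forall>s t. 0 \<le> s \<and> s \<le> t \<longrightarrow>
        distr M borel (\<lambda>\<omega>. X t \<omega> - X s \<omega>) = distr M borel (X (t - s))) \<and>
     (\<forall>\<omega>\<in>space M. \<forall>t\<ge>0. continuous (at_right t) (\<lambda>s. X s \<omega>)) \<and>
     (\<forall>\<omega>\<in>space M. \<forall>t>0. \<exists>l. ((\<lambda>s. X s \<omega>) \<longlongrightarrow> l) (at_left t))"

definition has_char_exponent ::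
  "'a measure \<Rightarrow> (real \<Rightarrow> 'a \<Rightarrow> real) \<Rightarrow> (real \<Rightarrow> complex) \<Rightarrow> bool" where
  "has_char_exponent M X \<Psi> \<longleftrightarrow>
     (\<forall>t\<ge>0. \<forall>z. char (distr M borel (X t)) z = exp (- (complex_of_real t * \<Psi> z)))"

text \<open>The characteristic exponent of the censored-stable Lamperti process xi-tilde.\<close>
definition Psi_tilde :: "real \<Rightarrow> real \<Rightarrow> real \<Rightarrow> complex" where
  "Psi_tilde \<alpha> \<rho> z =
     Gamma (complex_of_real (\<alpha> * \<rho>) - \<i> * complex_of_real z) / Gamma (- \<i> * complex_of_real z) *
     (Gamma (complex_of_real (1 - \<alpha> * \<rho>) + \<i> * complex_of_real z) /
      Gamma (complex_of_real (1 - \<alpha>) + \<i> * complex_of_real z))"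

definition potential :: "'a measure \<Rightarrow> (real \<Rightarrow> 'a \<Rightarrow> real) \<Rightarrow> real set \<Rightarrow> ennreal" where
  "potential M X A = (\<integral>\<^sup>+ t\<in>{0..}. emeasure (distr M borel (X t)) A \<partial>lborel)"

text \<open>The claimed (continuous version of the) potential density.\<close>
definition u_tilde :: "real \<Rightarrow> real \<Rightarrow> real \<Rightarrow> real" where
  "u_tilde \<alpha> \<rho> x =
    (if x > 0 then
       - (1/pi) * Gamma (1 - \<alpha>) * sin (pi * \<alpha> * \<rho>) * (1 - (1 - exp (-x)) powr (\<alpha> - 1))
       - (1/pi) * Gamma (1 - \<alpha>) * sin (pi * \<alpha> * (1 - \<rho>)) * exp (- (\<alpha> - 1) * x)
     else if x < 0 then
       - (1/pi) * Gamma (1 - \<alpha>) * sin (pi * \<alpha> * \<rho>)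
       - (1/pi) * Gamma (1 - \<alpha>) * sin (pi * \<alpha> * (1 - \<rho>)) * (1 - (1 - exp x) powr (\<alpha> - 1))
           * exp (- (\<alpha> - 1) * x)
     else
       - (1/pi) * Gamma (1 - \<alpha>) * (sin (pi * \<alpha> * \<rho>) + sin (pi * \<alpha> * (1 - \<rho>))))"

end

theory Submission
  imports Defs
begin

text \<open>
  Write \<open>c_pos\<close> for the limit of the claimed density \<open>u\<close> at \<open>-\<infinity>\<close>. Removing the constant \<open>c_pos\<close>
  on the negative half-line from \<open>u\<close> leaves an integrable function \<open>v\<close>; by Beta integrals and the
  reflection formula its Fourier transform is \<open>1/\<Psi>(z) - c_pos/(iz)\<close> for \<open>z \<noteq> 0\<close>. Here \<open>c_pos/(iz)\<close>
  is the symbol of the potential of the deterministic drift \<open>-1/c_pos\<close>, whose \<open>q\<close>-resolvent has Fourier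
  transform \<open>1/(q + iz/c_pos)\<close>, while the \<open>q\<close>-resolvent of the process has Fourier transform
  \<open>1/(q + \<Psi>(z))\<close>. Since \<open>Re \<Psi> \<ge> 0\<close>, the difference of these two is bounded by
  \<open>|1/\<Psi>(z) - c_pos/(iz)|\<close>, hence by the \<open>L\<^sup>1\<close>-norm of \<open>v\<close>, uniformly in \<open>q\<close>. So after multiplication by a
  Gaussian, which on the Fourier side is an average over a normal variable, one can let \<open>q\<close> tend to \<open>0\<close>.
  The potential measure and \<open>u(x) dx\<close>, both weighted by the Gaussian, then have equal characteristic
  functions and coincide by Levy's uniqueness theorem.
\<close>

section \<open>Laplace transforms of Beta type\<close>
lemma set_integral_FTC_Ioi:
  fixes f F :: "real \<Rightarrow> complex"
  assumes "\<And>x. x > 0 \<Longrightarrow> (F has_vector_derivative f x) (at x)"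
    and "\<And>x. x > 0 \<Longrightarrow> isCont f x"
    and "set_integrable lborel {0<..} f"
    and "(F \<longlongrightarrow> A) (at_right 0)" "(F \<longlongrightarrow> B) at_top"
  shows "(LBINT x:{0<..}. f x) = B - A"
proof -
  have e: "einterval 0 \<infinity> = {0::real<..}"
    by (auto simp: einterval_def)
  have "(LBINT x=0..\<infinity>. f x) = B - A"
  proof (rule interval_integral_FTC_integrable)
    show "((F \<circ> real_of_ereal) \<longlongrightarrow> A) (at_right 0)"
      using assms(4) by (simp add: zero_ereal_def ereal_tendsto_simps)
    show "((F \<circ> real_of_ereal) \<longlongrightarrow> B) (at_left \<infinity>)"
      using assms(5) by (simp add: ereal_tendsto_simps)
  qed (use assms e in auto)
  then show ?thesis
    by (simp add: interval_lebesgue_integral_def e)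
qed

text \<open>Integrability is inherited from the exponential distribution, whose density has total
  mass 1.\<close>

lemma set_integrable_exp_Ioi:
  fixes a :: real
  assumes "a > 0"
  shows "set_integrable lborel {0<..} (\<lambda>x. exp (- a * x))"
proof -
  have "integrable lborel (\<lambda>x. exponential_density a x)"
    using prob_space_exponential_density[OF assms]
    by (intro integrableI_nn_integral_finite[where x = 1])
       (use assms in \<open>auto simp: exponential_density_nonneg dest!: prob_space.emeasure_space_1 simp: emeasure_density\<close>)
  then have "integrable lborel (\<lambda>x. exponential_density a x / a)"
    by simp
  then have "set_integrable lborel {0..} (\<lambda>x. exp (- a * x))"
    unfolding set_integrable_def
    by (rule Bochner_Integration.integrable_cong[THEN iffD1, rotated 2])
       (use assms in \<open>auto simp: exponential_density_def indicator_def\<close>)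
  then show ?thesis
    by (rule set_integrable_subset) auto
qed

lemma set_integrable_cexp_Ioi:
  fixes f :: "real \<Rightarrow> complex"
  assumes "a > 0" "f \<in> borel_measurable borel" "\<And>x. x > 0 \<Longrightarrow> norm (f x) \<le> C * exp (- a * x)"
  shows "set_integrable lborel {0<..} f"
proof (rule set_integrable_bound)
  show "set_integrable lborel {0<..} (\<lambda>x. C * exp (- a * x))"
    using set_integrable_exp_Ioi[OF assms(1)] by (rule set_integrable_mult_right)
  show "set_borel_measurable lborel {0<..} f"
    using assms(2) unfolding set_borel_measurable_def by measurable
  show "AE x in lborel. x \<in> {0<..} \<longrightarrow> cmod (f x) \<le> norm (C * exp (- a * x))"
    using assms(3) by (auto intro!: AE_I2 intro: order_trans[OF assms(3)])
qed

lemma set_integral_cexp_Ioi: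
  fixes s :: complex
  assumes "Re s > 0"
  shows "set_integrable lborel {0<..} (\<lambda>x. exp (- s * of_real x))"
    and "(LBINT x:{0<..}. exp (- s * of_real x)) = 1 / s"
proof -
  show I: "set_integrable lborel {0<..} (\<lambda>x. exp (- s * of_real x))"
    by (rule set_integrable_cexp_Ioi[where a = "Re s" and C = 1]) (use assms in auto)
  have s: "s \<noteq> 0" using assms by auto
  have "(LBINT x:{0<..}. exp (- s * of_real x)) = 0 - (- 1 / s)"
  proof (rule set_integral_FTC_Ioi[OF _ _ I])
    show "((\<lambda>x. - exp (- s * of_real x) / s) has_vector_derivative exp (- s * of_real x)) (at x)" for x
      by (rule has_vector_derivative_real_field)
         (use s in \<open>auto intro!: derivative_eq_intros\<close>)
    have "((\<lambda>x::real. - exp (- s * of_real x) / s) \<longlongrightarrow> - exp (- s * of_real 0) / s) (at_right 0)"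
      using s by (intro tendsto_intros) auto
    then show "((\<lambda>x::real. - exp (- s * of_real x) / s) \<longlongrightarrow> - 1 / s) (at_right 0)"
      by simp
    have "((\<lambda>x. exp (- Re s * x)) \<longlongrightarrow> 0) at_top"
      using assms by real_asymp
    then have "((\<lambda>x. exp (- s * of_real x)) \<longlongrightarrow> 0) at_top"
      by (subst tendsto_norm_zero_iff[symmetric]) simp
    then have "((\<lambda>x::real. - exp (- s * of_real x) / s) \<longlongrightarrow> - 0 / s) at_top"
      using s by (intro tendsto_intros)
    then show "((\<lambda>x::real. - exp (- s * of_real x) / s) \<longlongrightarrow> 0) at_top" by simp
  qed (auto intro!: continuous_intros)
  then show "(LBINT x:{0<..}. exp (- s * of_real x)) = 1 / s" by simp
qed

text \<open>The substitution y = e^{-x} turns this into the Beta integral B(s, b+1), that is, the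
  integral of y^{s-1} (1-y)^b over (0,1).\<close>

definition beta_laplace :: "real \<Rightarrow> complex \<Rightarrow> complex" where
  "beta_laplace b s = (LBINT x:{0<..}. exp (- s * of_real x) * of_real ((1 - exp (- x)) powr b))"

section \<open>Convergence, functional equation and Gamma form of the Beta-type transform\<close>

lemma integrable_beta_laplace:
  assumes "b \<ge> 0" "Re s > 0"
  shows "set_integrable lborel {0<..} (\<lambda>x. exp (- s * of_real x) * of_real ((1 - exp (- x)) powr b))"
  by (rule set_integrable_cexp_Ioi[where a = "Re s" and C = 1])
     (use assms in \<open>auto simp: norm_mult intro!: powr_le1\<close>)

text \<open>A base w in [0,1] satisfies w^b >= w when b <= 1, so 1 - (1-e^{-x})^b is at most e^{-x}.
  This extra decay moves the abscissa of convergence to the left of the imaginary axis, where the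
  Fourier transform is needed.\<close>

lemma integrable_beta_laplace':
  assumes "0 < b" "b \<le> 1" "Re s > -1"
  shows "set_integrable lborel {0<..} (\<lambda>x. exp (- s * of_real x) * of_real (1 - (1 - exp (- x)) powr b))"
proof (rule set_integrable_cexp_Ioi[where a = "Re s + 1" and C = 1])
  fix x :: real assume x: "x > 0"
  have "(1 - exp (-x)) powr 1 \<le> (1 - exp (-x)) powr b"
    using x assms by (intro powr_mono') auto
  moreover have "(1 - exp (-x)) powr b \<le> 1"
    using x assms by (intro powr_le1) auto
  ultimately have "\<bar>1 - (1 - exp (- x)) powr b\<bar> \<le> exp (- x)"
    using x by auto
  then have "exp (- (Re s * x)) * \<bar>1 - (1 - exp (- x)) powr b\<bar> \<le> exp (- (Re s * x)) * exp (- x)"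
    by (intro mult_left_mono) auto
  then show "norm (exp (- s * of_real x) * of_real (1 - (1 - exp (- x)) powr b)) \<le> 1 * exp (- (Re s + 1) * x)"
    by (simp add: norm_mult exp_add[symmetric] algebra_simps del: of_real_diff)
qed (use assms in auto)

text \<open>Integrate the derivative of e^{-sx} (1 - (1-e^{-x})^{b+1}), whose limits are 1 at 0 and
  0 at infinity. With exponent b+1 instead of b the derivative contains no negative power of
  1-e^{-x}.\<close>

lemma beta_laplace_by_parts:
  assumes b: "0 < b" "b \<le> 1" and s: "Re s > -1"
  shows "s * (LBINT x:{0<..}. exp (- s * of_real x) * of_real (1 - (1 - exp (- x)) powr b))
          = 1 - (s + b + 1) * beta_laplace b (s + 1)"
proof -
  let ?w = "\<lambda>x::real. 1 - exp (- x)"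
  let ?j = "\<lambda>x::real. exp (- s * of_real x) * of_real (1 - ?w x powr b)"
  let ?i = "\<lambda>x::real. exp (- (s + 1) * of_real x) * of_real (?w x powr b)"
  let ?f = "\<lambda>x. - s * ?j x - (s + b + 1) * ?i x"
  let ?F = "\<lambda>x::real. exp (- s * of_real x) * of_real (1 - ?w x powr (b + 1))"
  have ij: "set_integrable lborel {0<..} ?j"
    using integrable_beta_laplace'[OF b s] .
  have ii: "set_integrable lborel {0<..} ?i"
    using b s by (intro integrable_beta_laplace) auto
  have "(LBINT x:{0<..}. ?f x) = 0 - 1"
  proof (rule set_integral_FTC_Ioi)
    fix x :: real assume x: "x > 0"
    then have w: "?w x > 0" by simp
    have "((\<lambda>x. 1 - ?w x powr (b + 1)) has_real_derivative - ((b + 1) * exp (-x) * ?w x powr b)) (at x)"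
    proof -
      have dw: "(?w has_real_derivative exp (-x)) (at x)"
        by (auto intro!: derivative_eq_intros)
      show ?thesis
        using DERIV_diff[OF DERIV_const[of 1] DERIV_fun_powr[OF dw w, of "b + 1"]] by (simp add: mult_ac)
    qed
    then have 1: "((\<lambda>x. complex_of_real (1 - ?w x powr (b + 1))) has_vector_derivative
        of_real (- ((b + 1) * exp (-x) * ?w x powr b))) (at x)"
      by (intro has_vector_derivative_of_real) (simp add: has_real_derivative_iff_has_vector_derivative)
    have 2: "((\<lambda>x. exp (- s * of_real x)) has_vector_derivative - s * exp (- s * of_real x)) (at x)"
      by (rule has_vector_derivative_real_field) (auto intro!: derivative_eq_intros)
    \<comment> \<open>With w = 1-e^{-x}, the split w^{b+1} = w^b - e^{-x} w^b separates the
      integrands of the two transforms, at s and at s+1.\<close>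
    have e: "exp (- s * of_real x) * of_real (- ((b + 1) * exp (-x) * ?w x powr b)) +
        - s * exp (- s * of_real x) * of_real (1 - ?w x powr (b + 1)) = ?f x"
    proof -
      have "exp (- (s + 1) * of_real x) = exp (- s * of_real x) * of_real (exp (- x))"
        by (simp add: exp_add[symmetric] algebra_simps exp_of_real[symmetric] del: exp_of_real)
      moreover have "?w x powr (b + 1) = (1 - exp (-x)) * ?w x powr b"
        using w by (simp add: powr_add)
      ultimately show ?thesis
        by (simp only: of_real_mult of_real_diff of_real_minus of_real_add of_real_1) (simp add: algebra_simps)
    qed
    show "(?F has_vector_derivative ?f x) (at x)"
      using has_vector_derivative_mult[OF 2 1] unfolding e .
    show "isCont ?f x"
      using w by (intro continuous_intros) auto
  next
    show "set_integrable lborel {0<..} ?f"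
      by (intro set_integral_diff set_integrable_mult_right ij ii)
    have "((\<lambda>x. ?w x powr (b + 1)) \<longlongrightarrow> 0) (at_right 0)"
    proof -
      have "((\<lambda>x. ?w x powr (b + 1)) \<longlongrightarrow> (1 - exp (- 0)) powr (b + 1)) (at_right 0)"
        using b by (intro tendsto_powr' tendsto_intros) (auto simp: eventually_at_right_less intro!: eventually_at_rightI[of 0 1])
      then show ?thesis by simp
    qed
    then have "(?F \<longlongrightarrow> exp (- s * of_real 0) * of_real (1 - 0)) (at_right 0)"
      by (intro tendsto_intros)
    then show "(?F \<longlongrightarrow> 1) (at_right 0)" by simp
    have "((\<lambda>x. 2 * exp (- (Re s + 1) * x)) \<longlongrightarrow> 0) at_top"
      using s by real_asymp
    then show "(?F \<longlongrightarrow> 0) at_top"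
    proof (rule Lim_null_comparison[rotated], intro eventually_mono[OF eventually_gt_at_top[of 0]])
      fix x :: real assume x: "x > 0"
      \<comment> \<open>As b+1 <= 2, the square is the smaller power, and w^2 >= 1 - 2 e^{-x}. The
        resulting majorant suffices for every Re s > -1.\<close>
      have "?w x powr 2 \<le> ?w x powr (b + 1)"
        using x b by (intro powr_mono') auto
      then have "(1 - exp (-x))^2 \<le> ?w x powr (b + 1)"
        using x by simp
      then have "1 - 2 * exp (-x) \<le> ?w x powr (b + 1)"
        by (rule order_trans[rotated]) (simp add: power2_eq_square algebra_simps)
      moreover have "?w x powr (b + 1) \<le> 1"
        using x b by (intro powr_le1) auto
      ultimately have "\<bar>1 - ?w x powr (b + 1)\<bar> \<le> 2 * exp (-x)"
        by auto
      then have "exp (- (Re s * x)) * \<bar>1 - ?w x powr (b + 1)\<bar> \<le> exp (- (Re s * x)) * (2 * exp (- x))"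
        by (intro mult_left_mono) auto
      then show "norm (?F x) \<le> 2 * exp (- (Re s + 1) * x)"
        by (simp add: norm_mult exp_add[symmetric] algebra_simps del: of_real_diff)
    qed
  qed
  moreover have "(LBINT x:{0<..}. ?f x) = - s * (LBINT x:{0<..}. ?j x) - (s + b + 1) * (LBINT x:{0<..}. ?i x)"
    unfolding set_integral_mult_right[symmetric]
    by (rule set_integral_diff) (intro set_integrable_mult_right ij ii)+
  ultimately show ?thesis
    unfolding beta_laplace_def by (simp add: algebra_simps)
qed

lemma beta_laplace_diff:
  assumes "b \<ge> 0" "Re s > 0"
  shows "(LBINT x:{0<..}. exp (- s * of_real x) * of_real (1 - (1 - exp (- x)) powr b)) = 1 / s - beta_laplace b s"
  unfolding beta_laplace_def set_integral_cexp_Ioi(2)[OF assms(2), symmetric]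
  by (subst set_integral_diff(2)[symmetric])
     (use integrable_beta_laplace[OF assms] set_integral_cexp_Ioi[OF assms(2)] in \<open>auto simp: algebra_simps\<close>)

text \<open>For Re s > 0 the complementary transform splits as in \<open>beta_laplace_diff\<close>,
  and the 1 produced by integration by parts cancels.\<close>

lemma beta_laplace_rec:
  assumes "0 < b" "b \<le> 1" "Re s > 0"
  shows "s * beta_laplace b s = (s + b + 1) * beta_laplace b (s + 1)"
proof -
  have "s * (1 / s - beta_laplace b s) = 1 - (s + b + 1) * beta_laplace b (s + 1)"
    using assms beta_laplace_by_parts[of b s] by (subst beta_laplace_diff[symmetric]) auto
  moreover have "s \<noteq> 0"
    using assms by auto
  ultimately show ?thesis
    by (simp add: algebra_simps)
qed

text \<open>At s = 0 the integral in \<open>beta_laplace_by_parts\<close> still converges, so the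
  left side vanishes; this gives the starting value for the recurrence.\<close>

lemma beta_laplace_1:
  assumes "0 < b" "b \<le> 1"
  shows "beta_laplace b 1 = 1 / (b + 1)"
proof -
  have "complex_of_real b + 1 \<noteq> 0"
    using assms by (auto simp: complex_eq_iff)
  then show ?thesis
    using beta_laplace_by_parts[of b 0] assms by (auto simp: field_simps)
qed

lemma beta_laplace_of_nat:
  assumes "0 < b" "b \<le> 1"
  shows "beta_laplace b (of_nat n + 1) = Gamma (of_nat n + 1) * Gamma (b + 1) / Gamma (of_nat n + b + 2)"
proof (induction n)
  case 0
  have "complex_of_real b + 1 \<noteq> 0"
    using assms by (auto simp: complex_eq_iff)
  moreover have "b + 1 \<notin> \<int>\<^sub>\<le>\<^sub>0"
    using assms by (auto simp: nonpos_Ints_def)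
  moreover have "Gamma (b + 1) \<noteq> 0"
    using assms Gamma_real_pos[of "b + 1"] by linarith
  ultimately show ?case
    using assms Gamma_plus1[of "b + 1"] by (auto simp: beta_laplace_1 add_ac)
next
  case (Suc n)
  let ?s = "of_nat n + 1 :: complex"
  have n0: "real n + 1 \<notin> \<int>\<^sub>\<le>\<^sub>0" "real n + b + 2 \<notin> \<int>\<^sub>\<le>\<^sub>0" "real n + b + 2 \<noteq> 0"
    using assms by (auto simp: nonpos_Ints_def)
  have c: "?s + b + 1 = of_real (real n + b + 2)"
    by simp
  have "?s * beta_laplace b ?s = (?s + b + 1) * beta_laplace b (?s + 1)"
    using assms by (intro beta_laplace_rec) auto
  then have "beta_laplace b (?s + 1) = of_real (real n + 1) * beta_laplace b ?s / of_real (real n + b + 2)"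
    unfolding c using n0(3)
    by (metis nonzero_eq_divide_eq mult.commute of_real_eq_0_iff of_real_of_nat_eq of_real_add of_real_1)
  also have "\<dots> = of_real ((real n + 1) * (Gamma (of_nat n + 1) * Gamma (b + 1) / Gamma (of_nat n + b + 2)) / (real n + b + 2))"
    unfolding Suc.IH by simp
  also have "(real n + 1) * (Gamma (of_nat n + 1) * Gamma (b + 1) / Gamma (of_nat n + b + 2)) / (real n + b + 2)
      = ((real n + 1) * Gamma (real n + 1)) * Gamma (b + 1) / ((real n + b + 2) * Gamma (real n + b + 2))"
    by (simp add: field_simps)
  also have "\<dots> = Gamma (real n + 1 + 1) * Gamma (b + 1) / Gamma (real n + b + 2 + 1)"
    by (simp only: Gamma_plus1[OF n0(1)] Gamma_plus1[OF n0(2)])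
  finally show ?case by (simp add: add_ac)
qed

text \<open>Euler's limit formula: \<open>rGamma_series s n\<close> is the Pochhammer symbol of s of
  length n+1 over n! n^s, and its product with Gamma s is the quotient shown.\<close>

lemma Gamma_of_nat_shift_asymp:
  fixes s :: complex
  assumes "s \<notin> \<int>\<^sub>\<le>\<^sub>0"
  shows "(\<lambda>n. Gamma (s + of_nat n + 1) / (fact n * exp (s * of_real (ln (of_nat n))))) \<longlonglongrightarrow> 1"
proof -
  have g: "Gamma s \<noteq> 0" using assms by (simp add: Gamma_eq_zero_iff)
  have "(\<lambda>n. rGamma_series s n) \<longlonglongrightarrow> rGamma s"
    by (rule tendsto_intros)
  then have "(\<lambda>n. Gamma s * rGamma_series s n) \<longlonglongrightarrow> Gamma s * rGamma s"
    by (intro tendsto_intros)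
  moreover have "Gamma s * rGamma s = 1"
    using g by (simp add: rGamma_inverse_Gamma)
  moreover have "Gamma s * rGamma_series s n = Gamma (s + of_nat n + 1) / (fact n * exp (s * of_real (ln (of_nat n))))" for n
    using pochhammer_Gamma[OF assms, of "n + 1"] g by (simp add: rGamma_series_def add_ac)
  ultimately show ?thesis by simp
qed

text \<open>For x > 0, |e^{-sx} - 1| <= |s| x <= |s| (e^x - 1). Multiplied by e^{-(n+1)x}, the last
  factor becomes e^{-nx} - e^{-(n+1)x}, so the bound integrates to a difference of transforms at n
  and n+1, which the recurrence evaluates. The transform at n converges because n >= 1.\<close>

lemma beta_laplace_shift_bound:
  assumes b: "0 < b" "b \<le> 1" and s: "Re s > 0" and n: "n \<ge> 1"
  shows "norm (beta_laplace b (s + of_nat n + 1) - beta_laplace b (of_nat n + 1))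
           \<le> norm s * ((b + 1) / real n) * norm (beta_laplace b (of_nat n + 1))"
proof -
  let ?w = "\<lambda>x::real. (1 - exp (- x)) powr b"
  let ?d = "\<lambda>x::real. exp (- of_nat n * complex_of_real x) * of_real (?w x) - exp (- (of_nat n + 1) * complex_of_real x) * of_real (?w x)"
  have i1: "set_integrable lborel {0<..} (\<lambda>x. exp (- (s + of_nat n + 1) * of_real x) * of_real (?w x))"
    using b s by (intro integrable_beta_laplace) auto
  have i2: "set_integrable lborel {0<..} (\<lambda>x. exp (- (of_nat n + 1) * of_real x) * complex_of_real (?w x))"
    using b s by (intro integrable_beta_laplace) auto
  have i3: "set_integrable lborel {0<..} (\<lambda>x. exp (- of_nat n * of_real x) * complex_of_real (?w x))"
    using b n by (intro integrable_beta_laplace) auto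
  have i4: "set_integrable lborel {0<..} ?d"
    using i2 i3 by (intro set_integral_diff)
  have d: "?d x = of_real (exp (- real n * x) * (1 - exp (- x)) * ?w x)" for x
  proof -
    have "exp (- (of_nat n + 1) * complex_of_real x) = exp (- of_nat n * of_real x) * of_real (exp (- x))"
      by (simp add: exp_add[symmetric] algebra_simps exp_of_real[symmetric] del: exp_of_real)
    moreover have "exp (- of_nat n * complex_of_real x) = of_real (exp (- real n * x))"
      by (simp add: exp_of_real[symmetric] del: exp_of_real)
    ultimately show ?thesis by (simp only:) (simp add: algebra_simps)
  qed
  have L: "(LBINT x:{0<..}. ?d x) = beta_laplace b (of_nat n) - beta_laplace b (of_nat n + 1)"
    unfolding beta_laplace_def by (rule set_integral_diff(2)[OF i3 i2])
  have "of_nat n * beta_laplace b (of_nat n) = (of_nat n + complex_of_real b + 1) * beta_laplace b (of_nat n + 1)"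
    using b n by (intro beta_laplace_rec) auto
  then have "beta_laplace b (of_nat n) - beta_laplace b (of_nat n + 1) = of_real ((b + 1) / real n) * beta_laplace b (of_nat n + 1)"
    using n by (simp add: field_simps)
  then have L2: "norm (LBINT x:{0<..}. ?d x) = ((b + 1) / real n) * norm (beta_laplace b (of_nat n + 1))"
    unfolding L using b by (simp only: norm_mult norm_of_real) simp
  have d4: "set_integrable lborel {0<..} (\<lambda>x. exp (- real n * x) * (1 - exp (- x)) * ?w x)"
    using i4 unfolding d set_integrable_def scaleR_conv_of_real[where 'a = complex] of_real_mult[symmetric]
    by (simp only: complex_of_real_integrable_eq real_scaleR_def)
  have L3: "(LBINT x:{0<..}. exp (- real n * x) * (1 - exp (- x)) * ?w x) = ((b + 1) / real n) * norm (beta_laplace b (of_nat n + 1))"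
  proof -
    have "(LBINT x:{0<..}. ?d x) = of_real (LBINT x:{0<..}. exp (- real n * x) * (1 - exp (- x)) * ?w x)"
      unfolding d by (rule set_integral_complex_of_real)
    moreover have "(LBINT x:{0<..}. exp (- real n * x) * (1 - exp (- x)) * ?w x) \<ge> 0"
      unfolding set_lebesgue_integral_def by (rule integral_nonneg_AE) (auto simp: indicator_def)
    ultimately show ?thesis using L2 by simp
  qed
  have "norm (beta_laplace b (s + of_nat n + 1) - beta_laplace b (of_nat n + 1))
     = norm (LBINT x:{0<..}. exp (- (s + of_nat n + 1) * of_real x) * of_real (?w x) - exp (- (of_nat n + 1) * of_real x) * complex_of_real (?w x))"
    unfolding beta_laplace_def using i1 i2 by (subst set_integral_diff(2)) auto
  also have "\<dots> \<le> (LBINT x:{0<..}. norm (exp (- (s + of_nat n + 1) * of_real x) * of_real (?w x) - exp (- (of_nat n + 1) * of_real x) * complex_of_real (?w x)))"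
    using i1 i2 by (intro set_integral_norm_bound set_integral_diff)
  also have "\<dots> \<le> (LBINT x:{0<..}. norm s * (exp (- real n * x) * (1 - exp (- x)) * ?w x))"
  proof (rule set_integral_mono)
    show "set_integrable lborel {0<..} (\<lambda>x. norm s * (exp (- real n * x) * (1 - exp (- x)) * ?w x))"
      using d4 by (intro set_integrable_mult_right)
    show "set_integrable lborel {0<..} (\<lambda>x. norm (exp (- (s + of_nat n + 1) * of_real x) * of_real (?w x) - exp (- (of_nat n + 1) * of_real x) * complex_of_real (?w x)))"
      using i1 i2 by (intro set_integrable_norm set_integral_diff)
    fix x :: real assume x: "x \<in> {0<..}"
    \<comment> \<open>Mean value estimate on the convex left half-plane, where the derivative of exp
      has modulus at most 1.\<close>
    have "norm (exp (- s * of_real x) - exp 0) \<le> norm s * x"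
    proof -
      have "norm (exp (- s * of_real x) - exp 0) \<le> 1 * norm (- s * of_real x - 0)"
      proof (rule field_differentiable_bound[where S = "{z. Re z \<le> 0}" and f' = exp])
        show "convex {z. Re z \<le> 0}" by (rule convex_halfspace_Re_le)
      qed (use s x in \<open>auto intro!: derivative_eq_intros\<close>)
      then show ?thesis using x by (simp add: norm_mult)
    qed
    also have "x \<le> exp x - 1"
      using exp_ge_add_one_self[of x] by linarith
    finally have 1: "norm (exp (- s * of_real x) - 1) \<le> norm s * (exp x - 1)"
      by (simp add: mult_left_mono)
    have "exp (- (s + of_nat n + 1) * of_real x) * of_real (?w x) - exp (- (of_nat n + 1) * of_real x) * complex_of_real (?w x)
       = (exp (- s * of_real x) - 1) * of_real (exp (- (real n + 1) * x) * ?w x)"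
      by (simp add: algebra_simps exp_add[symmetric] exp_of_real[symmetric] del: exp_of_real)
    then have "norm (exp (- (s + of_nat n + 1) * of_real x) * of_real (?w x) - exp (- (of_nat n + 1) * of_real x) * complex_of_real (?w x))
       = norm (exp (- s * of_real x) - 1) * (exp (- (real n + 1) * x) * ?w x)"
      by (simp only: norm_mult norm_of_real) simp
    also have "\<dots> \<le> norm s * (exp x - 1) * (exp (- (real n + 1) * x) * ?w x)"
      using 1 by (rule mult_right_mono) auto
    also have "\<dots> = norm s * (exp (- real n * x) * (1 - exp (- x)) * ?w x)"
      by (simp add: algebra_simps exp_add[symmetric])
    finally show "norm (exp (- (s + of_nat n + 1) * of_real x) * of_real (?w x) - exp (- (of_nat n + 1) * of_real x) * complex_of_real (?w x))
        \<le> norm s * (exp (- real n * x) * (1 - exp (- x)) * ?w x)" .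
  qed
  also have "\<dots> = norm s * ((b + 1) / real n) * norm (beta_laplace b (of_nat n + 1))"
    using L3 by (simp add: set_integral_mult_right)
  finally show ?thesis .
qed

text \<open>Both sides satisfy the same recurrence under \<open>s \<mapsto> s + 1\<close>, agree at the positive integers, and
  \<open>beta_laplace b (s + n)\<close> is asymptotic to \<open>beta_laplace b n\<close>; so their ratio is 1-periodic in \<open>s\<close> and tends to 1.\<close>

lemma beta_laplace_Gamma:
  assumes b: "0 < b" "b \<le> 1" and s: "Re s > 0"
  shows "beta_laplace b s = Gamma s * Gamma (b + 1) / Gamma (s + b + 1)"
proof -
  have nonpos: "z \<notin> \<int>\<^sub>\<le>\<^sub>0" if "Re z > 0" for z :: complex
    using that by (auto elim!: nonpos_Ints_cases)
  have gnz: "Gamma z \<noteq> 0" if "Re z > 0" for z :: complex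
    using nonpos[OF that] by (simp add: Gamma_eq_zero_iff)
  define R where "R z = beta_laplace b z * Gamma (z + b + 1) / Gamma z" for z
  have R_Suc: "R (z + 1) = R z" if z: "Re z > 0" for z
  proof -
    have "z + b + 1 \<noteq> 0" "z \<noteq> 0" using z b by (auto simp: complex_eq_iff)
    moreover have "Gamma (z + b + 1 + 1) = (z + b + 1) * Gamma (z + b + 1)" "Gamma (z + 1) = z * Gamma z"
      using z b by - (rule Gamma_plus1, rule nonpos, simp)+
    moreover have "z + 1 + b + 1 = z + b + 1 + 1" by simp
    moreover have "beta_laplace b z = (z + b + 1) * beta_laplace b (z + 1) / z"
      using beta_laplace_rec[OF b z] \<open>z \<noteq> 0\<close> by (simp add: field_simps)
    ultimately show ?thesis
      using gnz[OF z] unfolding R_def by (simp only:) simp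
  qed
  have R_n: "R (s + of_nat n) = R s" for n
  proof (induction n)
    case (Suc n)
    have "R (s + of_nat (Suc n)) = R (s + of_nat n + 1)" by (simp add: add_ac)
    also have "\<dots> = R (s + of_nat n)" using s by (intro R_Suc) auto
    finally show ?case using Suc by simp
  qed auto
  \<comment> \<open>Gamma (z+n+1) normalised by its leading growth n! n^z, so that each such factor
    tends to 1.\<close>
  define P where "P z n = Gamma (z + of_nat n + 1) / (fact n * exp (z * of_real (ln (of_nat n))))" for z :: complex and n
  have P: "P z \<longlonglongrightarrow> 1" if "Re z > 0" for z
    unfolding P_def using nonpos[OF that] by (rule Gamma_of_nat_shift_asymp)
  have P_nz: "P z n \<noteq> 0" if "Re z > 0" for z n
    unfolding P_def using that by (auto intro!: gnz)
  define B where "B = (\<lambda>n. beta_laplace b (s + of_nat n + 1) / beta_laplace b (of_nat n + 1))"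
  have Bn: "beta_laplace b (of_nat n + 1) \<noteq> 0" for n
    using b unfolding beta_laplace_of_nat[OF b]
    by (auto simp: Gamma_eq_zero_iff nonpos_Ints_def simp del: of_real_add)
  have B: "B \<longlonglongrightarrow> 1"
  proof -
    have "(\<lambda>n. norm s * ((b + 1) / real n)) \<longlonglongrightarrow> 0"
      by real_asymp
    then have "(\<lambda>n. B n - 1) \<longlonglongrightarrow> 0"
    proof (rule Lim_null_comparison[rotated], intro eventually_mono[OF eventually_ge_at_top[of 1]])
      fix n :: nat assume n: "n \<ge> 1"
      have "B n - 1 = (beta_laplace b (s + of_nat n + 1) - beta_laplace b (of_nat n + 1)) / beta_laplace b (of_nat n + 1)"
        using Bn[of n] by (simp add: B_def field_simps)
      then show "norm (B n - 1) \<le> norm s * ((b + 1) / real n)"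
        using beta_laplace_shift_bound[OF b s n] Bn[of n] by (simp add: norm_divide divide_le_eq)
    qed
    then show ?thesis by (simp add: LIM_zero_iff)
  qed
  \<comment> \<open>The powers of n cancel because s+b+1 is the sum of s and b+1, and so do the
    factorials. What is left is R at s+n+1, which equals R s by periodicity; letting n grow then
    gives the value of R s.\<close>
  have eq: "B n * P (s + b + 1) n / P s n / P (of_real (b + 1)) n * Gamma (of_real (b + 1)) = R s" for n
  proof -
    have alg: "B1 / (f * g / G0) * (G2 / (f * (E1 * E2))) / (G1 / (f * E1)) / (G0 / (f * E2)) * g = B1 * G2 / G1"
      if "f \<noteq> 0" "g \<noteq> 0" "G0 \<noteq> 0" "G1 \<noteq> 0" "E1 \<noteq> 0" "E2 \<noteq> 0" for B1 f g G0 G1 G2 E1 E2 :: complex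
      using that by (simp add: field_simps)
    have B0: "beta_laplace b (of_nat n + 1) = fact n * Gamma (of_real (b + 1)) / Gamma (complex_of_real (of_nat n + b + 2))"
      using Gamma_fact[of n, where 'a = complex]
      unfolding beta_laplace_of_nat[OF b] Gamma_complex_of_real[symmetric] of_real_divide of_real_mult
      by (simp add: add_ac)
    have e: "exp ((s + b + 1) * of_real (ln (of_nat n))) = exp (s * of_real (ln (of_nat n))) * exp (of_real (b + 1) * complex_of_real (ln (of_nat n)))"
      by (simp add: exp_add[symmetric] algebra_simps)
    have c: "of_real (b + 1) + of_nat n + 1 = complex_of_real (of_nat n + b + 2)" by simp
    have "B n * P (s + b + 1) n / P s n / P (of_real (b + 1)) n * Gamma (of_real (b + 1))
        = beta_laplace b (s + of_nat n + 1) * Gamma (s + b + 1 + of_nat n + 1) / Gamma (s + of_nat n + 1)"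
      unfolding B_def P_def B0 e c
      by (rule alg) (use b s in \<open>simp_all add: gnz del: of_real_add\<close>)
    also have "\<dots> = R (s + of_nat (Suc n))"
      by (simp add: R_def add_ac)
    also have "\<dots> = R s" by (rule R_n)
    finally show ?thesis .
  qed
  have "(\<lambda>n. B n * P (s + b + 1) n / P s n / P (of_real (b + 1)) n * Gamma (of_real (b + 1))) \<longlonglongrightarrow> 1 * 1 / 1 / 1 * Gamma (of_real (b + 1))"
    using s b by (intro tendsto_intros B P) auto
  then have "R s = Gamma (of_real (b + 1))"
    unfolding eq by (simp add: LIMSEQ_const_iff del: of_real_add)
  then show ?thesis
    unfolding R_def Gamma_complex_of_real using gnz[OF s] gnz[of "s + b + 1"] s b
    by (simp add: field_simps)
qed

text \<open>Integration by parts needs the transform only at s+1, which has positive real part; the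
  recurrence of Gamma then brings the arguments back from s+1 to s. This carries the Gamma form
  beyond Re s > 0.\<close>

lemma beta_laplace_compl_Gamma:
  assumes b: "0 < b" "b \<le> 1" and s: "Re s > -1" "s \<noteq> 0"
  shows "(LBINT x:{0<..}. exp (- s * of_real x) * of_real (1 - (1 - exp (- x)) powr b))
          = 1 / s - Gamma s * Gamma (b + 1) / Gamma (s + b + 1)" (is "?J = _")
proof -
  have 1: "s \<notin> \<int>\<^sub>\<le>\<^sub>0" "s + b + 1 \<notin> \<int>\<^sub>\<le>\<^sub>0"
    using b s by (force simp: nonpos_Ints_def complex_eq_iff)+
  then have 2: "s + b + 1 \<noteq> 0" by auto
  have "s * ?J = 1 - (s + b + 1) * (Gamma (s + 1) * Gamma (b + 1) / Gamma (s + 1 + b + 1))"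
    using b s by (subst beta_laplace_by_parts) (auto simp: beta_laplace_Gamma)
  also have "s + 1 + b + 1 = (s + b + 1) + 1" by simp
  also have "Gamma (s + b + 1 + 1) = (s + b + 1) * Gamma (s + b + 1)"
    using 1 by (intro Gamma_plus1)
  also have "Gamma (s + 1) = s * Gamma s"
    using 1 by (intro Gamma_plus1)
  also have "1 - (s + b + 1) * (s * Gamma s * Gamma (b + 1) / ((s + b + 1) * Gamma (s + b + 1)))
     = s * (1 / s - Gamma s * Gamma (b + 1) / Gamma (s + b + 1))"
  proof -
    have alg: "1 - c * (s * g * h / (c * k)) = s * (1 / s - g * h / k)" if "c \<noteq> 0" for c g h k :: complex
      using that s by (simp add: right_diff_distrib)
    show ?thesis by (rule alg[OF 2])
  qed
  finally show ?thesis using s by simp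
qed

text \<open>Reflection carries the negative half line to the positive one, and the origin is a null
  set; thus only half-line transforms have to be computed.\<close>

lemma integral_split_at_0:
  fixes f :: "real \<Rightarrow> complex"
  assumes 1: "set_integrable lborel {0<..} f" and 2: "set_integrable lborel {0<..} (\<lambda>x. f (- x))"
  shows "integrable lborel f"
    and "integral\<^sup>L lborel f = (LBINT x:{0<..}. f x) + (LBINT x:{0<..}. f (- x))"
proof -
  have "set_integrable lborel {..<0} f"
    using 2 lborel_integrable_real_affine[of "\<lambda>x. indicator {0<..} x *\<^sub>R f (- x)" "-1" 0]
    by (simp add: set_integrable_def indicator_def)
  with 1 have s: "set_integrable lborel ({0<..} \<union> {..<0}) f"
    by (rule set_integrable_Un) auto
  have n0: "AE x in lborel. x \<in> {0<..} \<union> {..<0::real}"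
    using AE_lborel_singleton[of 0] by eventually_elim auto
  have m: "f \<in> borel_measurable lborel"
  proof -
    have [measurable]: "(\<lambda>x. indicator ({0<..} \<union> {..<0}) x *\<^sub>R f x) \<in> borel_measurable borel"
      using s by (auto simp: set_integrable_def dest: borel_measurable_integrable)
    \<comment> \<open>The hypotheses give measurability away from 0 only; changing a single value
      does not affect it.\<close>
    have "f = (\<lambda>x. if x = 0 then f 0 else indicator ({0<..} \<union> {..<0}) x *\<^sub>R f x)"
      by (auto simp: fun_eq_iff indicator_def)
    also have "\<dots> \<in> borel_measurable lborel" by measurable
    finally show ?thesis .
  qed
  show "integrable lborel f"
    using s unfolding set_integrable_def
    by (rule integrable_cong_AE_imp) (use m n0 in \<open>auto\<close>)
  have "integral\<^sup>L lborel f = (LBINT x:{0<..} \<union> {..<0}. f x)"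
    unfolding set_lebesgue_integral_def
    by (rule integral_cong_AE) (use m n0 in \<open>auto\<close>)
  also have "\<dots> = (LBINT x:{0<..}. f x) + (LBINT x:{..<0}. f x)"
    using 1 \<open>set_integrable lborel {..<0} f\<close> by (intro set_integral_Un) auto
  also have "(LBINT x:{..<0}. f x) = (LBINT x:{0<..}. f (- x))"
    by (subst set_integral_reflect) (auto intro!: arg_cong2[where f = "set_lebesgue_integral lborel"])
  finally show "integral\<^sup>L lborel f = (LBINT x:{0<..}. f x) + (LBINT x:{0<..}. f (- x))" .
qed

text \<open>The reflection formula turns each reciprocal Gamma into a sine. What remains is sin(a+c)
  sin b = sin a sin(c+b) + sin(b-a) sin c with a = pi \<alpha> \<rho>, b = pi \<alpha>, c = pi s. At
  s = -iz the left side is the reciprocal of the characteristic exponent.\<close>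

lemma Gamma_quotient_reflection:
  fixes s :: complex and \<alpha> \<rho> :: real
  assumes s: "s \<notin> \<int>" "s + \<alpha> \<notin> \<int>" and \<alpha>: "1 < \<alpha>" "\<alpha> < 2"
  shows "Gamma s * Gamma (1 - \<alpha> - s) / (Gamma (\<alpha> * \<rho> + s) * Gamma (1 - \<alpha> * \<rho> - s))
    = (1 / pi) * Gamma (1 - \<alpha>) * Gamma \<alpha> *
       (sin (pi * \<alpha> * \<rho>) * Gamma s / Gamma (s + \<alpha>) +
        sin (pi * \<alpha> * (1 - \<rho>)) * Gamma (1 - \<alpha> - s) / Gamma (1 - s))"
proof -
  \<comment> \<open>In reciprocal form the formula holds for every z: Gamma takes the value 0 at its
    poles, so its inverse is 0 there as well.\<close>
  have refl: "inverse (Gamma z * Gamma w) = sin (of_real pi * z) / of_real pi" if "w = 1 - z" for z w :: complex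
    using rGamma_reflection_complex[of z] that by (simp add: rGamma_inverse_Gamma)
  have refl': "1 / Gamma w = Gamma z * sin (of_real pi * z) / of_real pi"
    if "w = 1 - z" "Gamma z \<noteq> 0" for z w :: complex
  proof -
    have "1 / B = A * C / p" if "inverse (A * B) = C / p" "A \<noteq> 0" for A B C p :: complex
      unfolding times_divide_eq_right[symmetric] that(1)[symmetric] using that(2) by (simp add: inverse_eq_divide)
    from this[OF refl[OF that(1)] that(2)] show ?thesis .
  qed
  have g: "Gamma s \<noteq> 0" "Gamma (1 - \<alpha> - s) \<noteq> 0"
  proof -
    show "Gamma s \<noteq> 0"
      using s by (auto simp: Gamma_eq_zero_iff dest: nonpos_Ints_Int)
    have "s + \<alpha> \<in> \<int>" if "1 - \<alpha> - s \<in> \<int>"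
      using Ints_diff[OF Ints_1 that] by (simp add: algebra_simps)
    then show "Gamma (1 - \<alpha> - s) \<noteq> 0"
      using s by (auto simp: Gamma_eq_zero_iff dest: nonpos_Ints_Int)
  qed
  \<comment> \<open>As 1 < \<alpha> < 2, the angle pi (\<alpha>-1) lies in (0, pi), so the sine of
    pi \<alpha> is negative and may be divided by.\<close>
  have sa: "sin (complex_of_real (pi * \<alpha>)) \<noteq> 0"
  proof -
    have "sin (pi * \<alpha>) = - sin (pi * (\<alpha> - 1))"
      by (simp add: right_diff_distrib)
    moreover have "sin (pi * (\<alpha> - 1)) > 0"
      using \<alpha> by (intro sin_gt_zero) auto
    ultimately have "sin (pi * \<alpha>) \<noteq> 0" by simp
    then show ?thesis by (simp add: sin_of_real del: of_real_mult)
  qed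
  have pi0: "complex_of_real pi \<noteq> 0" by simp
  have r1: "inverse (Gamma (\<alpha> * \<rho> + s) * Gamma (1 - \<alpha> * \<rho> - s)) = sin (of_real pi * (of_real (\<alpha> * \<rho>) + s)) / of_real pi"
    using refl[of "1 - \<alpha> * \<rho> - s" "of_real (\<alpha> * \<rho>) + s"] by simp
  have r2: "1 / Gamma (s + \<alpha>) = Gamma (1 - \<alpha> - s) * sin (of_real pi * (1 - \<alpha> - s)) / of_real pi"
    by (rule refl'[OF _ g(2)]) simp
  also have "sin (of_real pi * (1 - \<alpha> - s)) = sin (of_real pi * (s + \<alpha>))"
  proof -
    have e: "of_real pi * (1 - \<alpha> - s) = of_real pi - of_real pi * (s + \<alpha>)"
      by (simp add: ring_distribs)
    show ?thesis by (simp only: e sin_diff) simp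
  qed
  finally have r2: "1 / Gamma (s + \<alpha>) = Gamma (1 - \<alpha> - s) * sin (of_real pi * (s + \<alpha>)) / of_real pi" .
  have r3: "1 / Gamma (1 - s) = Gamma s * sin (of_real pi * s) / of_real pi"
    by (rule refl'[OF _ g(1)]) simp
  have r4: "complex_of_real (Gamma (1 - \<alpha>) * Gamma \<alpha>) = of_real pi / sin (of_real (pi * \<alpha>))"
    using Gamma_reflection_complex[of "of_real \<alpha>"]
    unfolding of_real_mult Gamma_complex_of_real[symmetric] by (simp add: mult.commute)
  have trig: "sin (of_real pi * (of_real (\<alpha> * \<rho>) + s)) * sin (of_real (pi * \<alpha>)) =
     sin (complex_of_real (pi * \<alpha> * \<rho>)) * sin (of_real pi * (s + \<alpha>)) + sin (complex_of_real (pi * \<alpha> * (1 - \<rho>))) * sin (of_real pi * s)"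
  proof -
    have "sin (a + c) * sin b = sin a * sin (c + b) + sin (b - a) * sin c" for a b c :: complex
      unfolding sin_add sin_diff by (simp add: algebra_simps)
    from this[of "of_real (pi * \<alpha> * \<rho>)" "of_real pi * s" "of_real (pi * \<alpha>)"] show ?thesis
      by (simp add: algebra_simps)
  qed
  have "Gamma s * Gamma (1 - \<alpha> - s) / (Gamma (\<alpha> * \<rho> + s) * Gamma (1 - \<alpha> * \<rho> - s))
    = Gamma s * Gamma (1 - \<alpha> - s) * (sin (of_real pi * (of_real (\<alpha> * \<rho>) + s)) / of_real pi)"
    unfolding divide_inverse[of _ "_ * _"] r1 ..
  also have "\<dots> = Gamma s * Gamma (1 - \<alpha> - s) / (of_real pi * sin (of_real (pi * \<alpha>))) *
     (sin (complex_of_real (pi * \<alpha> * \<rho>)) * sin (of_real pi * (s + \<alpha>)) + sin (complex_of_real (pi * \<alpha> * (1 - \<rho>))) * sin (of_real pi * s))"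
    unfolding trig[symmetric] using sa by simp
  also have "\<dots> = (1 / of_real pi) * (of_real pi / sin (of_real (pi * \<alpha>))) *
     (sin (of_real (pi * \<alpha> * \<rho>)) * Gamma s * (Gamma (1 - \<alpha> - s) * sin (of_real pi * (s + \<alpha>)) / of_real pi) +
      sin (of_real (pi * \<alpha> * (1 - \<rho>))) * Gamma (1 - \<alpha> - s) * (Gamma s * sin (of_real pi * s) / of_real pi))"
    using sa pi0 by (simp add: field_simps)
  also have "\<dots> = (1 / of_real pi) * of_real (Gamma (1 - \<alpha>) * Gamma \<alpha>) *
     (sin (of_real (pi * \<alpha> * \<rho>)) * Gamma s * (1 / Gamma (s + \<alpha>)) +
      sin (of_real (pi * \<alpha> * (1 - \<rho>))) * Gamma (1 - \<alpha> - s) * (1 / Gamma (1 - s)))"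
    unfolding r2 r3 r4 ..
  finally show ?thesis
    by (simp add: sin_of_real Gamma_complex_of_real del: of_real_mult of_real_diff)
qed

section \<open>Fourier transform of the density\<close>
locale censored_stable =
  fixes \<alpha> \<rho> :: real
  assumes \<alpha>: "1 < \<alpha>" "\<alpha> < 2"
    and \<rho>: "0 < \<alpha> * \<rho>" "\<alpha> * \<rho> < 1" "0 < \<alpha> * (1 - \<rho>)" "\<alpha> * (1 - \<rho>) < 1"
begin

section \<open>The two coefficients of the density and their signs\<close>

definition c_pos :: real where "c_pos = - Gamma (1 - \<alpha>) * sin (pi * \<alpha> * \<rho>) / pi"

definition c_neg :: real where "c_neg = - Gamma (1 - \<alpha>) * sin (pi * \<alpha> * (1 - \<rho>)) / pi"

text \<open>Gamma (2-\<alpha>) is positive and equals (1-\<alpha>) Gamma (1-\<alpha>), where the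
  first factor is negative.\<close>

lemma Gamma_one_minus_neg: "Gamma (1 - \<alpha>) < 0"
proof -
  have "1 - \<alpha> \<notin> \<int>\<^sub>\<le>\<^sub>0"
  proof
    assume "1 - \<alpha> \<in> \<int>\<^sub>\<le>\<^sub>0"
    then obtain n where n: "1 - \<alpha> = real_of_int n" by (auto simp: nonpos_Ints_def)
    with \<alpha> have "real_of_int (-1) < real_of_int n" "real_of_int n < real_of_int 0" by auto
    then show False unfolding of_int_less_iff by linarith
  qed
  then have "Gamma (2 - \<alpha>) = (1 - \<alpha>) * Gamma (1 - \<alpha>)"
    using Gamma_plus1[of "1 - \<alpha>"] by simp
  moreover have "Gamma (2 - \<alpha>) > 0"
    using \<alpha> by (intro Gamma_real_pos) auto
  ultimately show ?thesis
    using \<alpha> by (simp add: zero_less_mult_iff)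
qed

lemma c_pos_pos: "c_pos > 0" and c_neg_pos: "c_neg > 0"
proof -
  have "sin (pi * (\<alpha> * \<rho>)) > 0" "sin (pi * (\<alpha> * (1 - \<rho>))) > 0"
    using \<rho> by (auto intro!: sin_gt_zero)
  then show "c_pos > 0" "c_neg > 0"
    using Gamma_one_minus_neg unfolding c_pos_def c_neg_def
    by (auto intro!: divide_neg_pos mult_neg_pos simp: mult.assoc)
qed

section \<open>Branches, positivity and continuity of the claimed density\<close>

lemma u_tilde_pos_eq: "x > 0 \<Longrightarrow> u_tilde \<alpha> \<rho> x = c_pos * (1 - (1 - exp (- x)) powr (\<alpha> - 1)) + c_neg * exp (- (\<alpha> - 1) * x)"
  and u_tilde_neg_eq: "x < 0 \<Longrightarrow> u_tilde \<alpha> \<rho> x = c_pos + c_neg * (1 - (1 - exp x) powr (\<alpha> - 1)) * exp (- (\<alpha> - 1) * x)"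
  and u_tilde_0_eq: "u_tilde \<alpha> \<rho> 0 = c_pos + c_neg"
  by (auto simp: u_tilde_def c_pos_def c_neg_def algebra_simps add_divide_distrib diff_divide_distrib)

text \<open>Nonnegativity lets the function serve as a density in \<open>ennreal\<close>; strictness
  is what makes \<open>gauss_mass\<close> nonzero.\<close>

lemma u_tilde_pos: "u_tilde \<alpha> \<rho> x > 0"
proof -
  have p: "(1 - exp (- y)) powr (\<alpha> - 1) \<le> 1" if "y > 0" for y
    using that \<alpha> by (intro powr_le1) auto
  consider "x > 0" | "x < 0" | "x = 0" by linarith
  then show ?thesis
  proof cases
    case 1
    then show ?thesis
      using p[of x] c_pos_pos c_neg_pos by (auto simp: u_tilde_pos_eq intro!: add_nonneg_pos)
  next
    case 2
    then show ?thesis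
      using p[of "-x"] c_pos_pos c_neg_pos by (auto simp: u_tilde_neg_eq intro!: add_pos_nonneg)
  qed (use c_pos_pos c_neg_pos in \<open>simp add: u_tilde_0_eq\<close>)
qed

lemma measurable_u_tilde [measurable]: "u_tilde \<alpha> \<rho> \<in> borel_measurable borel"
  unfolding u_tilde_def[abs_def] by measurable

text \<open>The power with exponent \<alpha>-1 > 0 vanishes at the origin, so both one-sided limits
  are \<open>c_pos + c_neg\<close>.\<close>

lemma isCont_u_tilde_0: "isCont (u_tilde \<alpha> \<rho>) 0"
proof -
  have p: "((\<lambda>x. (1 - exp (- x)) powr (\<alpha> - 1)) \<longlongrightarrow> 0) (at_right 0)"
  proof -
    have "((\<lambda>x::real. (1 - exp (- x)) powr (\<alpha> - 1)) \<longlongrightarrow> (1 - exp (- 0)) powr (\<alpha> - 1)) (at_right 0)"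
      using \<alpha> by (intro tendsto_powr' tendsto_intros) (auto intro!: eventually_at_rightI[of 0 1])
    then show ?thesis using \<alpha> by simp
  qed
  have "((\<lambda>x. c_pos * (1 - (1 - exp (- x)) powr (\<alpha> - 1)) + c_neg * exp (- (\<alpha> - 1) * x)) \<longlongrightarrow>
     c_pos * (1 - 0) + c_neg * exp (- (\<alpha> - 1) * 0)) (at_right 0)"
    by (intro tendsto_intros p)
  then have r: "(u_tilde \<alpha> \<rho> \<longlongrightarrow> u_tilde \<alpha> \<rho> 0) (at_right 0)"
    unfolding u_tilde_0_eq
    by (rule Lim_transform_eventually[THEN tendsto_eq_rhs])
       (auto intro!: eventually_at_rightI[of 0 1] simp: u_tilde_pos_eq)
  have "((\<lambda>x. c_pos + c_neg * (1 - (1 - exp (- x)) powr (\<alpha> - 1)) * exp (- (\<alpha> - 1) * - x)) \<longlongrightarrow>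
     c_pos + c_neg * (1 - 0) * exp (- (\<alpha> - 1) * - 0)) (at_right 0)"
    by (intro tendsto_intros p)
  then have "((\<lambda>x. u_tilde \<alpha> \<rho> (- x)) \<longlongrightarrow> u_tilde \<alpha> \<rho> 0) (at_right 0)"
    unfolding u_tilde_0_eq
    by (rule Lim_transform_eventually[THEN tendsto_eq_rhs])
       (auto intro!: eventually_at_rightI[of 0 1] simp: u_tilde_neg_eq)
  then have "(u_tilde \<alpha> \<rho> \<longlongrightarrow> u_tilde \<alpha> \<rho> 0) (at_left 0)"
    by (subst filterlim_at_left_to_right) simp
  with r show ?thesis
    unfolding isCont_def by (intro filterlim_split_at)
qed

text \<open>The integrable function v of the introduction.\<close>

definition u_corr :: "real \<Rightarrow> real" where
  "u_corr x = u_tilde \<alpha> \<rho> x - (if x < 0 then c_pos else 0)"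

text \<open>Keeps all Gamma arguments that occur at a nonzero frequency away from the poles.\<close>

lemma imaginary_plus_real_notin_Ints:
  assumes "z \<noteq> 0" shows "- \<i> * complex_of_real z + of_real a \<notin> \<int>"
proof
  assume "- \<i> * complex_of_real z + of_real a \<in> \<int>"
  then obtain n where "- \<i> * complex_of_real z + of_real a = of_int n"
    by (elim Ints_cases)
  from arg_cong[OF this, of Im] assms show False by simp
qed

text \<open>With s = -iz, the positive half line contributes a complementary Beta transform at s and
  1/(s+b), the reflected negative half line one at -b-s. The terms 1/(s+b) and 1/(-b-s) cancel,
  c_pos/s is the drift term, and the Gamma quotients combine to the reciprocal exponent by
  \<open>Gamma_quotient_reflection\<close>.\<close>

lemma fourier_u_corr:
  shows "integrable lborel (\<lambda>x. complex_of_real (u_corr x) * iexp (z * x))"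
    and "z \<noteq> 0 \<Longrightarrow> (LBINT x. of_real (u_corr x) * iexp (z * x)) = 1 / Psi_tilde \<alpha> \<rho> z - c_pos / (\<i> * z)"
proof -
  define b where "b = \<alpha> - 1"
  have b: "0 < b" "b \<le> 1" "b < 1" using \<alpha> by (auto simp: b_def)
  define s where "s = - \<i> * complex_of_real z"
  define s' where "s' = - of_real b - s"
  let ?f = "\<lambda>x. complex_of_real (u_corr x) * iexp (z * x)"
  let ?h = "\<lambda>s x. exp (- s * of_real x) * complex_of_real (1 - (1 - exp (- x)) powr b)"
  let ?p = "\<lambda>x. c_pos * ?h s x + c_neg * exp (- (s + b) * complex_of_real x)"
  have f1: "?f x = ?p x" if x: "x \<in> {0<..}" for x
  proof -
    have "exp (- (s + b) * complex_of_real x) = exp (- s * of_real x) * of_real (exp (- b * x))"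
      by (simp add: exp_of_real[symmetric] exp_add[symmetric] algebra_simps del: exp_of_real)
    moreover have "iexp (z * x) = exp (- s * of_real x)"
      by (simp add: s_def algebra_simps)
    moreover have "u_corr x = c_pos * (1 - (1 - exp (- x)) powr b) + c_neg * exp (- b * x)"
      using that by (simp add: u_corr_def u_tilde_pos_eq b_def)
    ultimately show ?thesis
      by (simp only: of_real_add of_real_mult) (simp only: distrib_right mult.assoc mult.commute[of "exp (- s * complex_of_real x)"])
  qed
  have f2: "?f (- x) = c_neg * ?h s' x" if x: "x \<in> {0<..}" for x
  proof -
    have "exp (- s' * complex_of_real x) = exp (s * of_real x) * of_real (exp (b * x))"
      by (simp add: s'_def exp_of_real[symmetric] exp_add[symmetric] algebra_simps del: exp_of_real)
    moreover have "iexp (z * - x) = exp (s * of_real x)"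
      by (simp add: s_def algebra_simps)
    moreover have "u_corr (- x) = c_neg * (1 - (1 - exp (- x)) powr b) * exp (b * x)"
      using that by (simp add: u_corr_def u_tilde_neg_eq b_def algebra_simps)
    ultimately show ?thesis
      by (simp only: of_real_mult mult_ac)
  qed
  \<comment> \<open>Here Re s' = -b, and b < 1 because \<alpha> < 2; so the negative half line stays
    inside the region of convergence.\<close>
  have Re: "Re s > -1" "Re s' > -1" "Re (s + b) > 0"
    using b by (auto simp: s_def s'_def)
  have i1: "set_integrable lborel {0<..} (?h s)" "set_integrable lborel {0<..} (?h s')"
    by (rule integrable_beta_laplace'[OF b(1,2) Re(1)], rule integrable_beta_laplace'[OF b(1,2) Re(2)])
  have i2: "set_integrable lborel {0<..} (\<lambda>x. exp (- (s + b) * complex_of_real x))"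
    by (rule set_integral_cexp_Ioi(1)[OF Re(3)])
  have I1: "set_integrable lborel {0<..} ?p"
    by (intro set_integral_add(1) set_integrable_mult_right i1 i2)
  have J1: "set_integrable lborel {0<..} ?f"
    by (rule set_integrable_cong[OF refl refl f1, THEN iffD2, OF _ I1])
  have J2: "set_integrable lborel {0<..} (\<lambda>x. ?f (- x))"
    by (rule set_integrable_cong[OF refl refl f2, THEN iffD2, OF _ set_integrable_mult_right[OF i1(2)]])
  show "integrable lborel ?f"
    using integral_split_at_0(1)[OF J1 J2] .
  assume z: "z \<noteq> 0"
  have s0: "s \<noteq> 0" "s' \<noteq> 0"
    using z b by (auto simp: s_def s'_def complex_eq_iff)
  have nI: "s \<notin> \<int>" "s + \<alpha> \<notin> \<int>"
    using imaginary_plus_real_notin_Ints[OF z, of 0] imaginary_plus_real_notin_Ints[OF z, of \<alpha>] by (auto simp: s_def)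
  have "(LBINT x:{0<..}. ?f x) = (LBINT x:{0<..}. ?p x)"
    by (rule set_lebesgue_integral_cong) (simp, use f1 in blast)
  also have "\<dots> = (LBINT x:{0<..}. c_pos * ?h s x) + (LBINT x:{0<..}. c_neg * exp (- (s + b) * complex_of_real x))"
    by (intro set_integral_add(2) set_integrable_mult_right i1 i2)
  also have "\<dots> = c_pos * (1 / s - Gamma s * Gamma (b + 1) / Gamma (s + b + 1)) + c_neg * (1 / (s + b))"
    unfolding set_integral_mult_right set_integral_cexp_Ioi(2)[OF Re(3)] beta_laplace_compl_Gamma[OF b(1,2) Re(1) s0(1)] ..
  finally have K1: "(LBINT x:{0<..}. ?f x) = \<dots>" .
  have "(LBINT x:{0<..}. ?f (- x)) = (LBINT x:{0<..}. c_neg * ?h s' x)"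
    by (rule set_lebesgue_integral_cong) (simp, use f2 in blast)
  also have "\<dots> = c_neg * (1 / s' - Gamma s' * Gamma (b + 1) / Gamma (s' + b + 1))"
    unfolding set_integral_mult_right beta_laplace_compl_Gamma[OF b(1,2) Re(2) s0(2)] ..
  finally have K2: "(LBINT x:{0<..}. ?f (- x)) = \<dots>" .
  have c: "1 / s' = - (1 / (s + b))"
    using minus_divide_right[of 1 "s + b"] by (simp only: s'_def) simp
  have b1: "b + 1 = \<alpha>" "s + b + 1 = s + \<alpha>" "s' + b + 1 = 1 - s" and s': "s' = 1 - \<alpha> - s"
    by (simp_all add: b_def s'_def)
  have Psi: "1 / Psi_tilde \<alpha> \<rho> z = Gamma s * Gamma (1 - \<alpha> - s) / (Gamma (\<alpha> * \<rho> + s) * Gamma (1 - \<alpha> * \<rho> - s))"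
    unfolding Psi_tilde_def by (simp add: s_def algebra_simps)
  have cc: "- (c_pos / (\<i> * z)) = c_pos / s"
    using z by (simp add: s_def field_simps)
  have A: "integral\<^sup>L lborel ?f = c_pos / s -
      (c_pos * Gamma s * Gamma \<alpha> / Gamma (s + \<alpha>) + c_neg * Gamma (1 - \<alpha> - s) * Gamma \<alpha> / Gamma (1 - s))"
    unfolding integral_split_at_0(2)[OF J1 J2] K1 K2 c b1 unfolding s'
    by (simp only: right_diff_distrib times_divide_eq_right mult_1_right mult.assoc) simp
  have B: "c_pos * Gamma s * Gamma \<alpha> / Gamma (s + \<alpha>) + c_neg * Gamma (1 - \<alpha> - s) * Gamma \<alpha> / Gamma (1 - s)
     = - (1 / Psi_tilde \<alpha> \<rho> z)"
  proof -
    have alg: "- G * S1 / p * g1 * A / X + - G * S2 / p * g2 * A / Y = - ((1 / p) * G * A * (S1 * g1 / X + S2 * g2 / Y))"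
      for G S1 S2 p g1 g2 A X Y :: complex
      by (simp add: ring_distribs mult_ac)
    show ?thesis
      unfolding Psi Gamma_quotient_reflection[OF nI \<alpha>]
      unfolding c_pos_def c_neg_def of_real_mult of_real_divide of_real_minus of_real_1 by (rule alg)
  qed
  show "integral\<^sup>L lborel ?f = 1 / Psi_tilde \<alpha> \<rho> z - c_pos / (\<i> * z)"
    unfolding A B cc[symmetric] by simp
qed

lemma integrable_u_corr: "integrable lborel u_corr"
proof -
  have "complex_of_real (u_corr x) * iexp (0 * x) = complex_of_real (u_corr x)" for x
    by simp
  then show ?thesis
    using fourier_u_corr(1)[of 0] by (simp only: complex_of_real_integrable_eq)
qed

end

section \<open>Resolvents of the process\<close>
text \<open>The Gaussian is the characteristic function of the standard normal law, so a Gaussian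
  weight in space is a normal average over shifted frequencies. Fubini applies since the integrand
  has modulus |k p|, whatever y is. The general measure allows both the time-path product space and
  the real line.\<close>

lemma gaussian_smoothing:
  fixes k :: "'b \<Rightarrow> complex" and Y :: "'b \<Rightarrow> real"
  assumes "sigma_finite_measure N" and k: "integrable N k" and Y: "Y \<in> borel_measurable N"
  shows "(\<integral>p. k p * (of_real (exp (- (Y p)\<^sup>2 / 2)) * iexp (w * Y p)) \<partial>N)
       = (\<integral>y. (\<integral>p. k p * iexp ((w + y) * Y p) \<partial>N) \<partial>std_normal_distribution)"
    and "integrable std_normal_distribution (\<lambda>y. \<integral>p. k p * iexp ((w + y) * Y p) \<partial>N)"
proof -
  let ?G = std_normal_distribution
  interpret N: sigma_finite_measure N by fact
  interpret G: real_distribution ?G by (rule real_dist_normal_dist)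
  interpret P: pair_sigma_finite N ?G ..
  note [measurable] = Y borel_measurable_integrable[OF k]
  let ?f = "\<lambda>p y. k p * iexp ((w + y) * Y p)"
  have n: "norm (?f p y) = norm (k p)" for p y
    by (simp add: norm_mult)
  have f: "integrable (N \<Otimes>\<^sub>M ?G) (case_prod ?f)"
  proof (rule P.Fubini_integrable)
    show "case_prod ?f \<in> borel_measurable (N \<Otimes>\<^sub>M ?G)"
      by measurable
    show "integrable N (\<lambda>x. LINT y|?G. norm (case_prod ?f (x, y)))"
      using k by (simp only: prod.case n lebesgue_integral_const) (simp add: G.prob_space[simplified] integrable_norm)
    show "AE x in N. integrable ?G (\<lambda>y. case_prod ?f (x, y))"
    proof (rule AE_I2)
      fix p
      have "AE y in ?G. norm (?f p y) \<le> norm (k p)"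
        by (simp only: n order_refl AE_I2)
      then show "integrable ?G (\<lambda>y. case_prod ?f (p, y))"
        unfolding prod.case by (rule G.integrable_const_bound) measurable
    qed
  qed
  have "(\<integral>y. ?f p y \<partial>?G) = k p * (of_real (exp (- (Y p)\<^sup>2 / 2)) * iexp (w * Y p))" for p
  proof -
    have "?f p y = (k p * iexp (w * Y p)) * iexp (Y p * y)" for y
      by (simp add: algebra_simps exp_add)
    then have "(\<integral>y. ?f p y \<partial>?G) = (k p * iexp (w * Y p)) * (\<integral>y. iexp (Y p * y) \<partial>?G)"
      by (simp only: integral_mult_right_zero)
    also have "(\<integral>y. iexp (Y p * y) \<partial>?G) = char ?G (Y p)"
      by (simp add: char_def)
    also have "\<dots> = of_real (exp (- (Y p)\<^sup>2 / 2))"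
      by (simp add: char_std_normal_distribution)
    finally show ?thesis by (simp only: mult_ac)
  qed
  then show "(\<integral>p. k p * (of_real (exp (- (Y p)\<^sup>2 / 2)) * iexp (w * Y p)) \<partial>N) = (\<integral>y. (\<integral>p. ?f p y \<partial>N) \<partial>?G)"
    unfolding P.Fubini_integral[OF f] by (simp only:)
  show "integrable ?G (\<lambda>y. \<integral>p. ?f p y \<partial>N)"
    using P.integrable_snd[OF f] .
qed

text \<open>Times are approximated from the right by grid times. For each mesh only countably many
  times occur, so the approximants are jointly measurable, and right-continuity passes this to the
  limit.\<close>

lemma measurable_right_continuous_process:
  fixes X :: "real \<Rightarrow> 'a \<Rightarrow> real"
  assumes X: "\<And>t. X t \<in> borel_measurable M"
    and rc: "\<And>\<omega> t. \<omega> \<in> space M \<Longrightarrow> t \<ge> 0 \<Longrightarrow> continuous (at_right t) (\<lambda>s. X s \<omega>)"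
  shows "(\<lambda>p. X (max 0 (fst p)) (snd p)) \<in> borel_measurable (borel \<Otimes>\<^sub>M M)"
proof -
  \<comment> \<open>The added 1 makes the grid time strictly larger than \<open>max 0 t\<close>,
    even at grid points, as a limit along \<open>at_right\<close> requires.\<close>
  define r where "r n t = (real_of_int \<lfloor>max 0 t * (real n + 1)\<rfloor> + 1) / (real n + 1)" for n and t :: real
  have r_gt: "r n t > max 0 t" for n t
    unfolding r_def by (subst pos_less_divide_eq) linarith+
  have r_le: "r n t \<le> max 0 t + 1 / (real n + 1)" for n t
  proof -
    have "real_of_int \<lfloor>max 0 t * (real n + 1)\<rfloor> + 1 \<le> max 0 t * (real n + 1) + 1" by linarith
    then have "r n t \<le> (max 0 t * (real n + 1) + 1) / (real n + 1)"
      unfolding r_def by (intro divide_right_mono) auto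
    also have "\<dots> = max 0 t + 1 / (real n + 1)" by (simp add: field_simps)
    finally show ?thesis .
  qed
  have r: "filterlim (\<lambda>n. r n t) (at_right (max 0 t)) sequentially" for t
    unfolding filterlim_at
  proof
    show "(\<lambda>n. r n t) \<longlonglongrightarrow> max 0 t"
    proof (rule tendsto_sandwich[OF _ _ tendsto_const])
      have "(\<lambda>n. max 0 t + 1 / (real n + 1)) \<longlonglongrightarrow> max 0 t + 0"
        by (intro tendsto_add tendsto_const) real_asymp
      then show "(\<lambda>n. max 0 t + 1 / (real n + 1)) \<longlonglongrightarrow> max 0 t" by simp
    qed (use r_le r_gt in \<open>auto intro!: always_eventually less_imp_le\<close>)
    show "\<forall>\<^sub>F n in sequentially. r n t \<in> {max 0 t<..} \<and> r n t \<noteq> max 0 t"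
      using r_gt[of t] by (auto intro!: always_eventually simp: less_imp_neq[THEN not_sym])
  qed
  show ?thesis
  proof (rule borel_measurable_LIMSEQ_real)
    fix p assume "p \<in> space (borel \<Otimes>\<^sub>M M :: (real \<times> 'a) measure)"
    then have "snd p \<in> space M" by (auto simp: space_pair_measure)
    from rc[OF this, of "max 0 (fst p)"]
    have "((\<lambda>s. X s (snd p)) \<longlongrightarrow> X (max 0 (fst p)) (snd p)) (at_right (max 0 (fst p)))"
      by (simp add: continuous_within)
    from filterlim_compose[OF this r]
    show "(\<lambda>n. X (r n (fst p)) (snd p)) \<longlonglongrightarrow> X (max 0 (fst p)) (snd p)" .
  next
    fix n
    have "(\<lambda>p. (\<lambda>i p. X ((real_of_int i + 1) / (real n + 1)) (snd p)) \<lfloor>max 0 (fst p) * (real n + 1)\<rfloor> p) \<in> borel_measurable (borel \<Otimes>\<^sub>M M)"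
      by (rule measurable_compose_countable) (use X in measurable)
    then show "(\<lambda>p. X (r n (fst p)) (snd p)) \<in> borel_measurable (borel \<Otimes>\<^sub>M M)"
      by (simp add: r_def)
  qed
qed

locale censored_stable_process = censored_stable +
  fixes M :: "'a measure" and X :: "real \<Rightarrow> 'a \<Rightarrow> real"
  assumes levy: "levy_process M X" and char: "has_char_exponent M X (Psi_tilde \<alpha> \<rho>)"
begin

sublocale prob_space M
  using levy by (simp add: levy_process_def)

sublocale P: pair_sigma_finite lborel M ..

lemma X_measurable [measurable]: "X t \<in> borel_measurable M"
  using levy by (simp add: levy_process_def)

text \<open>Freezing the path at negative times makes right-continuity yield joint measurability on the whole line.\<close>

definition Y :: "real \<times> 'a \<Rightarrow> real" where "Y p = X (max 0 (fst p)) (snd p)"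

lemma Y_measurable [measurable]: "Y \<in> borel_measurable (lborel \<Otimes>\<^sub>M M)"
proof -
  have "(\<lambda>p. X (max 0 (fst p)) (snd p)) \<in> borel_measurable (borel \<Otimes>\<^sub>M M)"
    using levy by (intro measurable_right_continuous_process) (auto simp: levy_process_def)
  also have "borel_measurable (borel \<Otimes>\<^sub>M M) = (borel_measurable (lborel \<Otimes>\<^sub>M M) :: (real \<times> 'a \<Rightarrow> real) set)"
    by (intro measurable_cong_sets sets_pair_measure_cong) auto
  finally show ?thesis by (simp add: Y_def[abs_def])
qed

abbreviation \<Psi> :: "real \<Rightarrow> complex" where "\<Psi> \<equiv> Psi_tilde \<alpha> \<rho>"

lemma char_X:
  assumes "t \<ge> 0" shows "(\<integral>\<omega>. iexp (z * X t \<omega>) \<partial>M) = exp (- (of_real t * \<Psi> z))"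
proof -
  have "char (distr M borel (X t)) z = exp (- (of_real t * \<Psi> z))"
    using char assms by (auto simp: has_char_exponent_def)
  then show ?thesis
    unfolding char_def by (subst (asm) integral_distr) auto
qed

text \<open>A characteristic function has modulus at most 1; apply this at time 1.\<close>

lemma Re_Psi_nonneg: "Re (\<Psi> z) \<ge> 0"
proof -
  have "exp (- Re (\<Psi> z)) = norm (exp (- (of_real 1 * \<Psi> z)))" by simp
  also have "\<dots> = norm (\<integral>\<omega>. iexp (z * X 1 \<omega>) \<partial>M)"
    by (subst char_X) auto
  also have "\<dots> \<le> (\<integral>\<omega>. norm (iexp (z * X 1 \<omega>)) \<partial>M)"
    by (rule integral_norm_bound)
  also have "\<dots> = 1" by (simp add: prob_space)
  finally show ?thesis by simp
qed

text \<open>A weight on the time-path space: integrating against it with q > 0 gives the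
  \<open>q\<close>-resolvent, and q = 0 gives the potential measure.\<close>

definition kern :: "real \<Rightarrow> real \<times> 'a \<Rightarrow> real" where
  "kern q p = indicator {0<..} (fst p) * exp (- q * fst p)"

lemma kern_measurable [measurable]: "kern q \<in> borel_measurable (lborel \<Otimes>\<^sub>M M)"
  unfolding kern_def by measurable

lemma integrable_kern:
  assumes "q > 0" shows "integrable (lborel \<Otimes>\<^sub>M M) (kern q)"
proof (rule P.Fubini_integrable)
  have "integrable lborel (\<lambda>x. indicator {0<..} x * exp (- q * x))"
    using set_integrable_exp_Ioi[OF assms] by (simp add: set_integrable_def)
  then show "integrable lborel (\<lambda>x. LINT y|M. norm (kern q (x, y)))"
    by (simp add: kern_def prob_space abs_mult)
  show "AE x in lborel. integrable M (\<lambda>y. kern q (x, y))"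
    by (simp add: kern_def)
qed measurable

text \<open>Fubini puts the expectation inside, where it equals e^{-t \<Psi>(z)}; the time integral
  is then an exponential one with Re (q + \<Psi>(z)) > 0.\<close>

lemma fourier_kern:
  assumes q: "q > 0"
  shows "(\<integral>p. of_real (kern q p) * iexp (z * Y p) \<partial>(lborel \<Otimes>\<^sub>M M)) = 1 / (q + \<Psi> z)"
proof -
  have i: "integrable (lborel \<Otimes>\<^sub>M M) (\<lambda>p. complex_of_real (kern q p) * iexp (z * Y p))"
    by (rule Bochner_Integration.integrable_bound[OF integrable_kern[OF q]]) (auto simp: norm_mult)
  have "(\<integral>p. of_real (kern q p) * iexp (z * Y p) \<partial>(lborel \<Otimes>\<^sub>M M))
     = (\<integral>t. \<integral>\<omega>. of_real (kern q (t, \<omega>)) * iexp (z * Y (t, \<omega>)) \<partial>M \<partial>lborel)"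
    by (rule P.integral_fst'[symmetric, OF i])
  also have "\<dots> = (LBINT t:{0<..}. exp (- (q + \<Psi> z) * of_real t))"
    unfolding set_lebesgue_integral_def
  proof (rule Bochner_Integration.integral_cong[OF refl])
    fix t :: real
    show "(\<integral>\<omega>. of_real (kern q (t, \<omega>)) * iexp (z * Y (t, \<omega>)) \<partial>M) = indicator {0<..} t *\<^sub>R exp (- (q + \<Psi> z) * of_real t)"
    proof (cases "t > 0")
      case True
      have "(\<integral>\<omega>. of_real (kern q (t, \<omega>)) * iexp (z * Y (t, \<omega>)) \<partial>M) = (\<integral>\<omega>. of_real (exp (- q * t)) * iexp (z * X t \<omega>) \<partial>M)"
        using True by (simp add: kern_def Y_def)
      also have "\<dots> = of_real (exp (- q * t)) * (\<integral>\<omega>. iexp (z * X t \<omega>) \<partial>M)"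
        by (rule integral_mult_right_zero)
      also have "\<dots> = of_real (exp (- q * t)) * exp (- (of_real t * \<Psi> z))"
        using True by (subst char_X) auto
      also have "\<dots> = exp (- (q + \<Psi> z) * of_real t)"
        by (simp add: exp_of_real[symmetric] exp_add[symmetric] algebra_simps del: exp_of_real)
      finally show ?thesis using True by simp
    qed (simp add: kern_def)
  qed
  also have "\<dots> = 1 / (q + \<Psi> z)"
    using q Re_Psi_nonneg[of z] by (intro set_integral_cexp_Ioi(2)) auto
  finally show ?thesis .
qed

end

section \<open>The limit of vanishing killing rate\<close>
context censored_stable
begin

text \<open>Gamma has no zeros except the conventional ones at its poles, which a nonzero frequency
  avoids in all four factors.\<close>

lemma Psi_tilde_nonzero:
  assumes z: "z \<noteq> 0"
  shows "Psi_tilde \<alpha> \<rho> z \<noteq> 0"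
proof -
  have nz: "Gamma (of_real a - \<i> * of_real z) \<noteq> 0" "Gamma (of_real a + \<i> * of_real z) \<noteq> 0" for a
    using imaginary_plus_real_notin_Ints[OF z, of a] imaginary_plus_real_notin_Ints[of "- z" a] z
    by (auto simp: Gamma_eq_zero_iff add.commute dest!: nonpos_Ints_Int)
  show ?thesis
    unfolding Psi_tilde_def using nz[of "\<alpha> * \<rho>"] nz[of 0] nz[of "1 - \<alpha> * \<rho>"] nz[of "1 - \<alpha>"] by auto
qed

text \<open>The added term is the density of the \<open>q\<close>-resolvent of the drift \<open>-1/c_pos\<close>.\<close>

definition u_damped :: "real \<Rightarrow> real \<Rightarrow> real" where
  "u_damped q x = u_corr x + indicator {..<0} x * (c_pos * exp (q * c_pos * x))"

text \<open>Reflection gives an exponential integral with rate q c_pos + iz. The value is 1/(q +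
  iz/c_pos), in which iz/c_pos is the exponent of the drift.\<close>

lemma drift_resolvent:
  assumes q: "q > 0"
  shows "integrable lborel (\<lambda>x. complex_of_real (indicator {..<0} x * (c_pos * exp (q * c_pos * x))) * iexp (z * x))"
    and "(LBINT x. of_real (indicator {..<0} x * (c_pos * exp (q * c_pos * x))) * iexp (z * x)) = c_pos / (q * c_pos + \<i> * z)"
proof -
  let ?f = "\<lambda>x. complex_of_real (indicator {..<0} x * (c_pos * exp (q * c_pos * x))) * iexp (z * x)"
  let ?s = "of_real (q * c_pos) + \<i> * complex_of_real z"
  have Re: "Re ?s > 0" using q c_pos_pos by simp
  have e: "?f (- x) = c_pos * exp (- ?s * of_real x)" if "x \<in> {0<..}" for x
  proof -
    have "exp (- ?s * of_real x) = of_real (exp (q * c_pos * - x)) * iexp (z * - x)"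
      by (simp add: exp_of_real[symmetric] exp_add[symmetric] algebra_simps del: exp_of_real)
    then show ?thesis using that by simp
  qed
  have 0: "?f x = 0" if "x \<in> {0<..}" for x
    using that by simp
  have i0: "set_integrable lborel {0<..} ?f"
    by (rule set_integrable_cong[OF refl refl 0, THEN iffD2]) (auto simp: set_integrable_def)
  have i1: "set_integrable lborel {0<..} (\<lambda>x. ?f (- x))"
    by (rule set_integrable_cong[OF refl refl e, THEN iffD2, OF _ set_integrable_mult_right[OF set_integral_cexp_Ioi(1)[OF Re]]])
  show "integrable lborel ?f"
    by (rule integral_split_at_0(1)[OF i0 i1])
  have "(LBINT x:{0<..}. ?f x) = set_lebesgue_integral lborel {0<..} (\<lambda>x::real. 0 :: complex)"
    by (rule set_lebesgue_integral_cong) (simp, intro allI impI, erule 0)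
  moreover have "(LBINT x:{0<..}. ?f (- x)) = (LBINT x:{0<..}. c_pos * exp (- ?s * of_real x))"
    by (rule set_lebesgue_integral_cong) (simp, use e in blast)
  moreover have "\<dots> = c_pos * (1 / ?s)"
    unfolding set_integral_mult_right set_integral_cexp_Ioi(2)[OF Re] ..
  ultimately show "integral\<^sup>L lborel ?f = c_pos / (q * c_pos + \<i> * z)"
    unfolding integral_split_at_0(2)[OF i0 i1] by (simp add: set_lebesgue_integral_def)
qed

lemma integrable_u_damped:
  assumes q: "q > 0" shows "integrable lborel (\<lambda>x. complex_of_real (u_damped q x))"
proof -
  have "integrable lborel (\<lambda>x. complex_of_real (u_corr x) * iexp (0 * x) +
     complex_of_real (indicator {..<0} x * (c_pos * exp (q * c_pos * x))) * iexp (0 * x))"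
    by (intro Bochner_Integration.integrable_add fourier_u_corr drift_resolvent q)
  then show ?thesis by (simp add: u_damped_def)
qed

lemma fourier_u_damped:
  assumes q: "q > 0" and z: "z \<noteq> 0"
  shows "(LBINT x. of_real (u_damped q x) * iexp (z * x)) = 1 / Psi_tilde \<alpha> \<rho> z - c_pos / (\<i> * z) + c_pos / (q * c_pos + \<i> * z)"
  unfolding u_damped_def of_real_add distrib_right
    Bochner_Integration.integral_add[OF fourier_u_corr(1) drift_resolvent(1)[OF q]]
  by (simp only: fourier_u_corr(2)[OF z] drift_resolvent(2)[OF q])

text \<open>At a nonzero frequency the left side is the distance between 1/\<Psi>(z) and c_pos/(iz),
  so this supplies the domination that is uniform in frequency and in q.\<close>

lemma norm_fourier_u_corr_le: "norm (LBINT x. of_real (u_corr x) * iexp (z * x)) \<le> (LBINT x. \<bar>u_corr x\<bar>)"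
  by (rule order_trans[OF integral_norm_bound]) (simp add: norm_mult)

lemma tendsto_u_damped: "(\<lambda>n. u_damped (inverse (real (Suc n))) x) \<longlonglongrightarrow> u_tilde \<alpha> \<rho> x"
proof -
  have "(\<lambda>n. u_damped (inverse (real (Suc n))) x) \<longlonglongrightarrow> u_corr x + indicator {..<0} x * (c_pos * exp (0 * c_pos * x))"
    unfolding u_damped_def by (intro tendsto_intros LIMSEQ_inverse_real_of_nat)
  moreover have "u_corr x + indicator {..<0} x * (c_pos * exp (0 * c_pos * x)) = u_tilde \<alpha> \<rho> x"
    by (simp add: u_corr_def indicator_def)
  ultimately show ?thesis by (simp only:)
qed

section \<open>Convergence of the Gaussian-weighted damped densities\<close>

lemma integrable_gauss: "integrable lborel (\<lambda>x::real. exp (- x\<^sup>2 / 2))"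
proof -
  have "integrable lborel std_normal_density" by simp
  then have "integrable lborel (\<lambda>x. sqrt (2 * pi) * std_normal_density x)" by (intro integrable_mult_right) simp
  then show ?thesis by (simp add: std_normal_density_def)
qed

text \<open>Both the damped densities and their limit exceed \<open>u_corr\<close> by an amount
  between 0 and \<open>c_pos\<close>. The Gaussian makes this bounded excess integrable, so one
  majorant serves for all q.\<close>

lemma u_damped_gauss_limit:
  "(\<lambda>n. LBINT x. of_real (u_damped (inverse (real (Suc n))) x) * (of_real (exp (- x\<^sup>2 / 2)) * iexp (w * x)))
     \<longlonglongrightarrow> (LBINT x. of_real (u_tilde \<alpha> \<rho> x) * (of_real (exp (- x\<^sup>2 / 2)) * iexp (w * x)))"
  and integrable_u_gauss: "integrable lborel (\<lambda>x. u_tilde \<alpha> \<rho> x * exp (- x\<^sup>2 / 2))"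
proof -
  let ?B = "\<lambda>x. \<bar>u_corr x\<bar> + c_pos * exp (- x\<^sup>2 / 2)"
  have [measurable]: "u_corr \<in> borel_measurable borel"
    using borel_measurable_integrable[OF integrable_u_corr] by simp
  have g1: "exp (- x\<^sup>2 / 2) \<le> 1" for x :: real by simp
  have B: "integrable lborel ?B"
    using integrable_u_corr integrable_gauss by (intro Bochner_Integration.integrable_add) auto
  have bound: "\<bar>u_corr x + e\<bar> * exp (- x\<^sup>2 / 2) \<le> ?B x" if "0 \<le> e" "e \<le> c_pos" for x e
  proof -
    have "\<bar>u_corr x + e\<bar> * exp (- x\<^sup>2 / 2) \<le> (\<bar>u_corr x\<bar> + c_pos) * exp (- x\<^sup>2 / 2)"
      using that by (intro mult_right_mono) auto
    also have "\<dots> \<le> ?B x"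
      using mult_left_mono[OF g1[of x], of "\<bar>u_corr x\<bar>"] by (simp add: distrib_right)
    finally show ?thesis .
  qed
  have bound_u: "\<bar>u_tilde \<alpha> \<rho> x\<bar> * exp (- x\<^sup>2 / 2) \<le> ?B x" for x
    using bound[of "if x < 0 then c_pos else 0" x] c_pos_pos by (auto simp: u_corr_def)
  have bound_d: "\<bar>u_damped q x\<bar> * exp (- x\<^sup>2 / 2) \<le> ?B x" if "q > 0" for q x
  proof -
    have "exp (q * c_pos * x) \<le> 1" if "x < 0"
      using that \<open>q > 0\<close> c_pos_pos by (auto simp: mult_le_0_iff)
    then have "indicator {..<0} x * (c_pos * exp (q * c_pos * x)) \<le> c_pos"
      using c_pos_pos by (auto simp: indicator_def)
    then show ?thesis
      unfolding u_damped_def using c_pos_pos by (intro bound) auto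
  qed
  show "integrable lborel (\<lambda>x. u_tilde \<alpha> \<rho> x * exp (- x\<^sup>2 / 2))"
  proof (rule Bochner_Integration.integrable_bound[OF B])
    show "AE x in lborel. norm (u_tilde \<alpha> \<rho> x * exp (- x\<^sup>2 / 2)) \<le> norm (?B x)"
    proof (rule AE_I2)
      fix x show "norm (u_tilde \<alpha> \<rho> x * exp (- x\<^sup>2 / 2)) \<le> norm (?B x)"
        using bound_u[of x] by (simp only: real_norm_def abs_mult abs_exp_cancel)
    qed
  qed measurable
  show "(\<lambda>n. LBINT x. of_real (u_damped (inverse (real (Suc n))) x) * (of_real (exp (- x\<^sup>2 / 2)) * iexp (w * x)))
     \<longlonglongrightarrow> (LBINT x. of_real (u_tilde \<alpha> \<rho> x) * (of_real (exp (- x\<^sup>2 / 2)) * iexp (w * x)))"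
  proof (rule integral_dominated_convergence[OF _ _ B])
    show "AE x in lborel. (\<lambda>n. complex_of_real (u_damped (inverse (real (Suc n))) x) * (of_real (exp (- x\<^sup>2 / 2)) * iexp (w * x)))
       \<longlonglongrightarrow> of_real (u_tilde \<alpha> \<rho> x) * (of_real (exp (- x\<^sup>2 / 2)) * iexp (w * x))"
      by (intro AE_I2 tendsto_intros tendsto_u_damped)
    show "AE x in lborel. norm (complex_of_real (u_damped (inverse (real (Suc n))) x) * (of_real (exp (- x\<^sup>2 / 2)) * iexp (w * x))) \<le> ?B x" for n
    proof (rule AE_I2)
      fix x
      have "norm (complex_of_real (u_damped (inverse (real (Suc n))) x) * (of_real (exp (- x\<^sup>2 / 2)) * iexp (w * x)))
          = \<bar>u_damped (inverse (real (Suc n))) x\<bar> * exp (- x\<^sup>2 / 2)"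
        by (simp only: norm_mult norm_of_real norm_exp_i_times abs_exp_cancel mult_1_right)
      also have "\<dots> \<le> ?B x" by (rule bound_d) simp
      finally show "norm (complex_of_real (u_damped (inverse (real (Suc n))) x) * (of_real (exp (- x\<^sup>2 / 2)) * iexp (w * x))) \<le> ?B x" .
    qed
  qed (unfold u_damped_def, measurable)
qed

end

text \<open>The difference has modulus |a-P| / (|q+P| |q+a|), and adding q > 0 to a number in the
  closed right half-plane does not decrease its modulus.\<close>

lemma resolvent_diff_le:
  fixes P a :: complex and q :: real
  assumes "P \<noteq> 0" "a \<noteq> 0" "Re P \<ge> 0" "Re a \<ge> 0" "q > 0"
  shows "norm (1 / (q + P) - 1 / (q + a)) \<le> norm (1 / P - 1 / a)"
proof -
  have le: "norm w \<le> norm (q + w)" if "Re w \<ge> 0" for w :: complex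
  proof -
    have "(Re w)\<^sup>2 \<le> (q + Re w)\<^sup>2"
      using that assms(5) by (intro power_mono) auto
    then show ?thesis by (simp add: cmod_def)
  qed
  have nz: "q + P \<noteq> 0" "q + a \<noteq> 0"
    using le[OF assms(3)] le[OF assms(4)] assms(1,2) by force+
  have "norm (1 / (q + P) - 1 / (q + a)) = norm (a - P) / (norm (q + P) * norm (q + a))"
    using nz by (simp add: diff_frac_eq norm_divide norm_mult)
  also have "\<dots> \<le> norm (a - P) / (norm P * norm a)"
    using assms le nz by (intro divide_left_mono mult_mono mult_pos_pos) auto
  also have "\<dots> = norm (1 / P - 1 / a)"
    using assms by (simp add: diff_frac_eq norm_divide norm_mult)
  finally show ?thesis .
qed

context censored_stable_process
begin

text \<open>Smoothing turns the gap between the weighted resolvent and the weighted damped density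
  into a normal average of differences of Fourier transforms. These tend to 0 at nonzero frequencies
  and are dominated by a constant, so the resolvent inherits the limit of the damped
  density.\<close>

lemma kern_gauss_limit:
  "(\<lambda>n. \<integral>p. of_real (kern (inverse (real (Suc n))) p) * (of_real (exp (- (Y p)\<^sup>2 / 2)) * iexp (w * Y p)) \<partial>(lborel \<Otimes>\<^sub>M M))
     \<longlonglongrightarrow> (LBINT x. of_real (u_tilde \<alpha> \<rho> x) * (of_real (exp (- x\<^sup>2 / 2)) * iexp (w * x)))"
proof -
  let ?G = std_normal_distribution
  interpret G: real_distribution ?G by (rule real_dist_normal_dist)
  define q where "q n = inverse (real (Suc n))" for n
  have q: "q n > 0" for n by (simp add: q_def)
  have q0: "q \<longlonglongrightarrow> 0"
    unfolding q_def[abs_def] by (rule LIMSEQ_inverse_real_of_nat)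
  let ?K = "\<lambda>n. \<integral>p. of_real (kern (q n) p) * (of_real (exp (- (Y p)\<^sup>2 / 2)) * iexp (w * Y p)) \<partial>(lborel \<Otimes>\<^sub>M M)"
  let ?L = "\<lambda>n. LBINT x. of_real (u_damped (q n) x) * (of_real (exp (- x\<^sup>2 / 2)) * iexp (w * x))"
  let ?k = "\<lambda>n z. \<integral>p. complex_of_real (kern (q n) p) * iexp (z * Y p) \<partial>(lborel \<Otimes>\<^sub>M M)"
  let ?l = "\<lambda>n z. LBINT x. complex_of_real (u_damped (q n) x) * iexp (z * x)"
  have ik: "integrable (lborel \<Otimes>\<^sub>M M) (\<lambda>p. complex_of_real (kern (q n) p))" for n
    using integrable_kern[OF q] by simp
  note sK = gaussian_smoothing[OF P.sigma_finite_measure_axioms ik Y_measurable, of _ w]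
  have "(\<lambda>x. x) \<in> borel_measurable (lborel :: real measure)" by simp
  note sL = gaussian_smoothing[OF lborel.sigma_finite_measure_axioms integrable_u_damped[OF q] this, of _ w]
  have diff: "?K n - ?L n = (\<integral>y. ?k n (w + y) - ?l n (w + y) \<partial>?G)" for n
    unfolding sK(1) sL(1) using sK(2) sL(2) by (rule Bochner_Integration.integral_diff[symmetric])
  \<comment> \<open>The transform formulas hold only at nonzero frequencies; the normal law has no
    atom at -w.\<close>
  have ae: "AE y in ?G. w + y \<noteq> 0"
    by (subst AE_density) (use AE_lborel_singleton[of "- w"] in \<open>auto elim!: eventually_mono\<close>)
  have kl: "?k n z - ?l n z = 1 / (q n + \<Psi> z) - c_pos / (q n * c_pos + \<i> * z) - (1 / \<Psi> z - c_pos / (\<i> * z))" if "z \<noteq> 0" for n z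
    unfolding fourier_kern[OF q] fourier_u_damped[OF q that] by simp
  have "(\<lambda>n. \<integral>y. ?k n (w + y) - ?l n (w + y) \<partial>?G) \<longlonglongrightarrow> (\<integral>y. 0 \<partial>?G)"
  proof (rule integral_dominated_convergence)
    show "integrable ?G (\<lambda>y. 2 * (LBINT x. \<bar>u_corr x\<bar>))" by (rule G.integrable_const)
    show "(\<lambda>y. ?k n (w + y) - ?l n (w + y)) \<in> borel_measurable ?G" for n
      by (intro borel_measurable_diff borel_measurable_integrable sK(2) sL(2))
    show "AE y in ?G. (\<lambda>n. ?k n (w + y) - ?l n (w + y)) \<longlonglongrightarrow> 0"
      using ae
    proof eventually_elim
      fix y assume z: "w + y \<noteq> 0"
      let ?z = "w + y"
      have "(\<lambda>n. 1 / (q n + \<Psi> ?z) - c_pos / (q n * c_pos + \<i> * ?z) - (1 / \<Psi> ?z - c_pos / (\<i> * ?z)))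
         \<longlonglongrightarrow> 1 / (of_real 0 + \<Psi> ?z) - c_pos / (of_real 0 * c_pos + \<i> * ?z) - (1 / \<Psi> ?z - c_pos / (\<i> * ?z))"
        unfolding of_real_mult of_real_add
        by (intro tendsto_intros q0) (use z Psi_tilde_nonzero[OF z] in \<open>auto simp: complex_eq_iff intro: q0\<close>)
      then show "(\<lambda>n. ?k n ?z - ?l n ?z) \<longlonglongrightarrow> 0"
        unfolding kl[OF z] by simp
    qed
    \<comment> \<open>The factor 2 collects one norm for the difference of the resolvents and one
      for the transform of \<open>u_corr\<close>.\<close>
    show "AE y in ?G. norm (?k n (w + y) - ?l n (w + y)) \<le> 2 * (LBINT x. \<bar>u_corr x\<bar>)" for n
      using ae
    proof eventually_elim
      fix y assume z: "w + y \<noteq> 0"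
      let ?z = "w + y"
      let ?V = "LBINT x. \<bar>u_corr x\<bar>"
      let ?a = "\<i> * of_real ?z / complex_of_real c_pos"
      have V: "norm (1 / \<Psi> ?z - c_pos / (\<i> * ?z)) \<le> ?V"
        using norm_fourier_u_corr_le[of ?z] unfolding fourier_u_corr(2)[OF z] .
      have a: "c_pos / (\<i> * ?z) = 1 / ?a" "c_pos / (q n * c_pos + \<i> * ?z) = 1 / (q n + ?a)"
        using c_pos_pos by (auto simp: field_simps)
      have "norm (1 / (q n + \<Psi> ?z) - 1 / (q n + ?a)) \<le> norm (1 / \<Psi> ?z - 1 / ?a)"
        using z Psi_tilde_nonzero[OF z] c_pos_pos Re_Psi_nonneg q
        by (intro resolvent_diff_le) (auto simp del: of_real_add)
      then have "norm (1 / (q n + \<Psi> ?z) - c_pos / (q n * c_pos + \<i> * ?z)) \<le> ?V"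
        using V unfolding a by linarith
      then show "norm (?k n ?z - ?l n ?z) \<le> 2 * ?V"
        unfolding kl[OF z] using V norm_triangle_ineq4 by (smt (verit))
    qed
  qed simp
  then have "(\<lambda>n. ?K n - ?L n) \<longlonglongrightarrow> 0"
    unfolding diff by simp
  from tendsto_add[OF this u_damped_gauss_limit[of w, folded q_def]]
  show ?thesis unfolding q_def by simp
qed

end

section \<open>Identification of the potential measure\<close>
context censored_stable_process
begin

abbreviation N :: "(real \<times> 'a) measure" where "N \<equiv> lborel \<Otimes>\<^sub>M M"

text \<open>The potential measure has infinite mass; the Gaussian weight in the position makes it
  finite, so that characteristic functions become available.\<close>

definition gauss_kern :: "real \<times> 'a \<Rightarrow> real" where
  "gauss_kern p = kern 0 p * exp (- (Y p)\<^sup>2 / 2)"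

lemma gauss_kern_measurable [measurable]: "gauss_kern \<in> borel_measurable N"
  unfolding gauss_kern_def by measurable

lemma kern_gauss_mono:
  "kern (inverse (real (Suc n))) p * exp (- (Y p)\<^sup>2 / 2) \<le> gauss_kern p"
  "n \<le> m \<Longrightarrow> kern (inverse (real (Suc n))) p * exp (- (Y p)\<^sup>2 / 2) \<le> kern (inverse (real (Suc m))) p * exp (- (Y p)\<^sup>2 / 2)"
proof -
  have kern_mono: "kern q p \<le> kern r p" if "r \<le> q" for q r
    using that by (auto simp: kern_def indicator_def mult_right_mono)
  show "kern (inverse (real (Suc n))) p * exp (- (Y p)\<^sup>2 / 2) \<le> gauss_kern p"
    unfolding gauss_kern_def by (intro mult_right_mono kern_mono) auto
  show "kern (inverse (real (Suc n))) p * exp (- (Y p)\<^sup>2 / 2) \<le> kern (inverse (real (Suc m))) p * exp (- (Y p)\<^sup>2 / 2)" if "n \<le> m"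
    using that by (intro mult_right_mono kern_mono le_imp_inverse_le) auto
qed

lemma kern_gauss_tendsto: "(\<lambda>n. kern (inverse (real (Suc n))) p * exp (- (Y p)\<^sup>2 / 2)) \<longlonglongrightarrow> gauss_kern p"
  unfolding gauss_kern_def kern_def by (intro tendsto_intros LIMSEQ_inverse_real_of_nat)

lemma integrable_kern_gauss: "integrable N (\<lambda>p. kern (inverse (real (Suc n))) p * exp (- (Y p)\<^sup>2 / 2))"
proof (rule Bochner_Integration.integrable_bound[OF integrable_kern[of "inverse (real (Suc n))"]])
  show "AE p in N. norm (kern (inverse (real (Suc n))) p * exp (- (Y p)\<^sup>2 / 2)) \<le> norm (kern (inverse (real (Suc n))) p)"
    by (intro AE_I2) (simp add: abs_mult mult_left_le)
qed auto

text \<open>Defined from the claimed density; it turns out to be the mass of the weighted potential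
  measure too, so one constant normalises both.\<close>

definition gauss_mass :: real where "gauss_mass = (LBINT x. u_tilde \<alpha> \<rho> x * exp (- x\<^sup>2 / 2))"

text \<open>The weighted resolvents increase as q decreases, and frequency 0 in
  \<open>kern_gauss_limit\<close> gives a finite limit for their integrals. Monotone convergence
  then yields integrability together with the value.\<close>

lemma has_integral_gauss_kern: "integrable N gauss_kern" "integral\<^sup>L N gauss_kern = gauss_mass"
proof -
  have "(\<lambda>n. of_real (\<integral>p. kern (inverse (real (Suc n))) p * exp (- (Y p)\<^sup>2 / 2) \<partial>N)) \<longlonglongrightarrow> complex_of_real gauss_mass"
    using kern_gauss_limit[of 0] unfolding gauss_mass_def integral_complex_of_real[symmetric] by simp
  then have lim: "(\<lambda>n. \<integral>p. kern (inverse (real (Suc n))) p * exp (- (Y p)\<^sup>2 / 2) \<partial>N) \<longlonglongrightarrow> gauss_mass"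
    by (simp only: tendsto_of_real_iff)
  have m: "AE p in N. mono (\<lambda>n. kern (inverse (real (Suc n))) p * exp (- (Y p)\<^sup>2 / 2))"
    using kern_gauss_mono(2) by (intro AE_I2) (simp only: mono_def, blast)
  have l: "AE p in N. (\<lambda>n. kern (inverse (real (Suc n))) p * exp (- (Y p)\<^sup>2 / 2)) \<longlonglongrightarrow> gauss_kern p"
    using kern_gauss_tendsto by simp
  show "integrable N gauss_kern"
    by (rule integrable_monotone_convergence[OF integrable_kern_gauss m l lim]) measurable
  show "integral\<^sup>L N gauss_kern = gauss_mass"
    by (rule integral_monotone_convergence[OF integrable_kern_gauss m l lim]) measurable
qed

text \<open>Now that \<open>gauss_kern\<close> is integrable it dominates the weighted resolvents,
  so their transforms converge to that of \<open>gauss_kern\<close>; \<open>kern_gauss_limit\<close>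
  identifies the same limit.\<close>

lemma fourier_gauss_kern:
  "(\<integral>p. of_real (gauss_kern p) * iexp (w * Y p) \<partial>N) = (LBINT x. of_real (u_tilde \<alpha> \<rho> x * exp (- x\<^sup>2 / 2)) * iexp (w * x))"
proof -
  have "(\<lambda>n. \<integral>p. of_real (kern (inverse (real (Suc n))) p * exp (- (Y p)\<^sup>2 / 2)) * iexp (w * Y p) \<partial>N)
      \<longlonglongrightarrow> (\<integral>p. of_real (gauss_kern p) * iexp (w * Y p) \<partial>N)"
  proof (rule integral_dominated_convergence[OF _ _ has_integral_gauss_kern(1)])
    show "AE p in N. (\<lambda>n. of_real (kern (inverse (real (Suc n))) p * exp (- (Y p)\<^sup>2 / 2)) * iexp (w * Y p)) \<longlonglongrightarrow> of_real (gauss_kern p) * iexp (w * Y p)"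
      by (intro AE_I2 tendsto_mult tendsto_of_real kern_gauss_tendsto tendsto_const)
    show "AE p in N. norm (of_real (kern (inverse (real (Suc n))) p * exp (- (Y p)\<^sup>2 / 2)) * iexp (w * Y p)) \<le> gauss_kern p" for n
    proof (rule AE_I2)
      fix p
      have "kern (inverse (real (Suc n))) p * exp (- (Y p)\<^sup>2 / 2) \<ge> 0" by (simp add: kern_def)
      then show "norm (of_real (kern (inverse (real (Suc n))) p * exp (- (Y p)\<^sup>2 / 2)) * iexp (w * Y p)) \<le> gauss_kern p"
        using kern_gauss_mono(1)[of n p] by (simp only: norm_mult norm_of_real norm_exp_i_times mult_1_right abs_of_nonneg)
    qed
  qed measurable
  moreover have "(\<lambda>n. \<integral>p. of_real (kern (inverse (real (Suc n))) p * exp (- (Y p)\<^sup>2 / 2)) * iexp (w * Y p) \<partial>N)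
      \<longlonglongrightarrow> (LBINT x. of_real (u_tilde \<alpha> \<rho> x * exp (- x\<^sup>2 / 2)) * iexp (w * x))"
    using kern_gauss_limit[of w] by (simp only: of_real_mult mult.assoc)
  ultimately show ?thesis by (rule LIMSEQ_unique)
qed

text \<open>A nonnegative function with zero integral vanishes almost everywhere, which a strictly
  positive one cannot do.\<close>

lemma gauss_mass_pos: "gauss_mass > 0"
proof -
  have "gauss_mass \<ge> 0"
    unfolding gauss_mass_def using u_tilde_pos by (intro integral_nonneg_AE AE_I2) (simp add: less_imp_le)
  moreover have "gauss_mass \<noteq> 0"
  proof
    assume "gauss_mass = 0"
    then have "AE x in lborel. u_tilde \<alpha> \<rho> x * exp (- x\<^sup>2 / 2) = 0"
      unfolding gauss_mass_def by (subst (asm) integral_nonneg_eq_0_iff_AE[OF integrable_u_gauss])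
        (auto simp: u_tilde_pos less_imp_le)
    moreover have "u_tilde \<alpha> \<rho> x * exp (- x\<^sup>2 / 2) \<noteq> 0" for x
      using u_tilde_pos[of x] by simp
    ultimately have "AE x in (lborel :: real measure). False"
      by simp
    then show False
      by (subst (asm) AE_iff_null) (auto simp: null_sets_def)
  qed
  ultimately show ?thesis by simp
qed

text \<open>Dividing by the common mass gives two probability laws on the line. Their characteristic
  functions agree by \<open>fourier_gauss_kern\<close>, so uniqueness applies.\<close>

lemma gauss_weighted_potential:
  "distr (density N (\<lambda>p. ennreal (gauss_kern p / gauss_mass))) borel Y
    = density lborel (\<lambda>x. ennreal (u_tilde \<alpha> \<rho> x * exp (- x\<^sup>2 / 2) / gauss_mass))" (is "?D1 = ?D2")
proof (rule Levy_uniqueness)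
  have gk: "gauss_kern p \<ge> 0" for p by (simp add: gauss_kern_def kern_def)
  have ug: "u_tilde \<alpha> \<rho> x * exp (- x\<^sup>2 / 2) \<ge> 0" for x using u_tilde_pos[of x] by simp
  have Y': "Y \<in> borel_measurable (density N (\<lambda>p. ennreal (gauss_kern p / gauss_mass)))" by simp
  have "emeasure (density N (\<lambda>p. ennreal (gauss_kern p / gauss_mass))) (space N) = (\<integral>\<^sup>+p. ennreal (gauss_kern p / gauss_mass) \<partial>N)"
    by (subst emeasure_density[OF _ sets.top]) (auto intro!: nn_integral_cong)
  also have "\<dots> = ennreal (\<integral>p. gauss_kern p / gauss_mass \<partial>N)"
    using gk gauss_mass_pos has_integral_gauss_kern by (intro nn_integral_eq_integral) auto
  also have "\<dots> = 1"
    using gauss_mass_pos has_integral_gauss_kern by simp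
  finally have "prob_space (density N (\<lambda>p. ennreal (gauss_kern p / gauss_mass)))"
    by (intro prob_spaceI) simp
  then show "real_distribution ?D1"
    by (rule prob_space.real_distribution_distr[OF _ Y'])
  have "emeasure ?D2 UNIV = (\<integral>\<^sup>+x. ennreal (u_tilde \<alpha> \<rho> x * exp (- x\<^sup>2 / 2) / gauss_mass) \<partial>lborel)"
    by (subst emeasure_density) (auto intro!: nn_integral_cong)
  also have "\<dots> = ennreal (LBINT x. u_tilde \<alpha> \<rho> x * exp (- x\<^sup>2 / 2) / gauss_mass)"
    using ug gauss_mass_pos integrable_u_gauss by (intro nn_integral_eq_integral) auto
  also have "\<dots> = 1"
    using gauss_mass_pos by (simp only: integral_divide_zero gauss_mass_def[symmetric]) simp
  finally show "real_distribution ?D2"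
    by (intro real_distribution.intro prob_spaceI real_distribution_axioms.intro) simp_all
  show "char ?D1 = char ?D2"
  proof
    fix w
    have "char ?D1 w = (\<integral>p. iexp (w * Y p) \<partial>density N (\<lambda>p. ennreal (gauss_kern p / gauss_mass)))"
      unfolding char_def by (rule integral_distr[OF Y']) simp
    also have "\<dots> = (\<integral>p. (gauss_kern p / gauss_mass) *\<^sub>R iexp (w * Y p) \<partial>N)"
      using gk gauss_mass_pos by (intro integral_density) auto
    also have "\<dots> = (\<integral>p. (of_real (gauss_kern p) * iexp (w * Y p)) / of_real gauss_mass \<partial>N)"
      by (simp add: scaleR_conv_of_real)
    also have "\<dots> = (\<integral>p. of_real (gauss_kern p) * iexp (w * Y p) \<partial>N) / of_real gauss_mass"
      by (rule integral_divide_zero)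
    also have "\<dots> = (LBINT x. of_real (u_tilde \<alpha> \<rho> x * exp (- x\<^sup>2 / 2)) * iexp (w * x)) / of_real gauss_mass"
      unfolding fourier_gauss_kern ..
    also have "\<dots> = (LBINT x. (of_real (u_tilde \<alpha> \<rho> x * exp (- x\<^sup>2 / 2)) * iexp (w * x)) / of_real gauss_mass)"
      by (rule integral_divide_zero[symmetric])
    also have "\<dots> = (LBINT x. (u_tilde \<alpha> \<rho> x * exp (- x\<^sup>2 / 2) / gauss_mass) *\<^sub>R iexp (w * x))"
      by (simp add: scaleR_conv_of_real)
    also have "\<dots> = char ?D2 w"
      unfolding char_def using ug gauss_mass_pos by (intro integral_density[symmetric]) auto
    finally show "char ?D1 w = char ?D2 w" .
  qed
qed

text \<open>Tonelli on the time-path space. The kernel omits time 0, which \<open>potential\<close>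
  includes, but a single time is a null set.\<close>

lemma potential_eq_nn_integral:
  assumes A [measurable]: "A \<in> sets borel"
  shows "potential M X A = (\<integral>\<^sup>+p. ennreal (kern 0 p) * indicator A (Y p) \<partial>N)"
proof -
  have "(\<integral>\<^sup>+p. ennreal (kern 0 p) * indicator A (Y p) \<partial>N) = (\<integral>\<^sup>+t. \<integral>\<^sup>+\<omega>. ennreal (kern 0 (t, \<omega>)) * indicator A (Y (t, \<omega>)) \<partial>M \<partial>lborel)"
    by (rule nn_integral_fst[symmetric]) measurable
  also have "\<dots> = potential M X A"
    unfolding potential_def
  proof (rule nn_integral_cong_AE)
    show "AE t in lborel. (\<integral>\<^sup>+\<omega>. ennreal (kern 0 (t, \<omega>)) * indicator A (Y (t, \<omega>)) \<partial>M) = emeasure (distr M borel (X t)) A * indicator {0..} t"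
      using AE_lborel_singleton[of 0]
    proof eventually_elim
      fix t :: real assume "t \<noteq> 0"
      show "(\<integral>\<^sup>+\<omega>. ennreal (kern 0 (t, \<omega>)) * indicator A (Y (t, \<omega>)) \<partial>M) = emeasure (distr M borel (X t)) A * indicator {0..} t"
      proof (cases "t > 0")
        case True
        have "(\<integral>\<^sup>+\<omega>. ennreal (kern 0 (t, \<omega>)) * indicator A (Y (t, \<omega>)) \<partial>M) = (\<integral>\<^sup>+\<omega>. indicator A (X t \<omega>) \<partial>M)"
          using True by (simp add: kern_def Y_def)
        also have "\<dots> = (\<integral>\<^sup>+x. indicator A x \<partial>distr M borel (X t))"
          by (rule nn_integral_distr[symmetric]) measurable
        also have "\<dots> = emeasure (distr M borel (X t)) A"
          by (rule nn_integral_indicator) simp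
        finally show ?thesis using True by simp
      qed (use \<open>t \<noteq> 0\<close> in \<open>simp add: kern_def\<close>)
    qed
  qed
  finally show ?thesis ..
qed

text \<open>Integrating \<open>gauss_mass\<close> times e^{x^2/2} over A against both sides of
  \<open>gauss_weighted_potential\<close> removes the Gaussian and the normalisation. Nonnegative
  integrals allow this even when both sides are infinite.\<close>

lemma potential_eq:
  assumes A [measurable]: "A \<in> sets borel"
  shows "potential M X A = (\<integral>\<^sup>+x\<in>A. ennreal (u_tilde \<alpha> \<rho> x) \<partial>lborel)"
proof -
  let ?h = "\<lambda>x::real. ennreal (gauss_mass * exp (x\<^sup>2 / 2)) * indicator A x"
  have gk: "gauss_kern p \<ge> 0" for p by (simp add: gauss_kern_def kern_def)
  have "potential M X A = (\<integral>\<^sup>+p. ennreal (gauss_kern p / gauss_mass) * ?h (Y p) \<partial>N)"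
    unfolding potential_eq_nn_integral[OF A]
  proof (rule nn_integral_cong)
    fix p
    have "kern 0 p = (gauss_kern p / gauss_mass) * (gauss_mass * exp ((Y p)\<^sup>2 / 2))"
      using gauss_mass_pos by (simp add: gauss_kern_def exp_minus)
    moreover have "gauss_kern p / gauss_mass \<ge> 0" "gauss_mass * exp ((Y p)\<^sup>2 / 2) \<ge> 0"
      using gk[of p] gauss_mass_pos by auto
    ultimately have "ennreal (kern 0 p) = ennreal (gauss_kern p / gauss_mass) * ennreal (gauss_mass * exp ((Y p)\<^sup>2 / 2))"
      by (simp only: ennreal_mult)
    then show "ennreal (kern 0 p) * indicator A (Y p) = ennreal (gauss_kern p / gauss_mass) * ?h (Y p)"
      by (simp add: mult.assoc)
  qed
  also have "\<dots> = (\<integral>\<^sup>+p. ?h (Y p) \<partial>density N (\<lambda>p. ennreal (gauss_kern p / gauss_mass)))"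
    by (rule nn_integral_density[symmetric]) measurable
  also have "\<dots> = (\<integral>\<^sup>+x. ?h x \<partial>distr (density N (\<lambda>p. ennreal (gauss_kern p / gauss_mass))) borel Y)"
    by (rule nn_integral_distr[symmetric]) measurable
  also have "\<dots> = (\<integral>\<^sup>+x. ennreal (u_tilde \<alpha> \<rho> x * exp (- x\<^sup>2 / 2) / gauss_mass) * ?h x \<partial>lborel)"
    unfolding gauss_weighted_potential by (rule nn_integral_density) measurable
  also have "\<dots> = (\<integral>\<^sup>+x\<in>A. ennreal (u_tilde \<alpha> \<rho> x) \<partial>lborel)"
  proof (rule nn_integral_cong)
    fix x
    have "u_tilde \<alpha> \<rho> x = (u_tilde \<alpha> \<rho> x * exp (- x\<^sup>2 / 2) / gauss_mass) * (gauss_mass * exp (x\<^sup>2 / 2))"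
      using gauss_mass_pos by (simp add: exp_minus)
    moreover have "u_tilde \<alpha> \<rho> x * exp (- x\<^sup>2 / 2) / gauss_mass \<ge> 0" "gauss_mass * exp (x\<^sup>2 / 2) \<ge> 0"
      using u_tilde_pos[of x] gauss_mass_pos by auto
    ultimately have "ennreal (u_tilde \<alpha> \<rho> x) = ennreal (u_tilde \<alpha> \<rho> x * exp (- x\<^sup>2 / 2) / gauss_mass) * ennreal (gauss_mass * exp (x\<^sup>2 / 2))"
      by (metis ennreal_mult)
    then show "ennreal (u_tilde \<alpha> \<rho> x * exp (- x\<^sup>2 / 2) / gauss_mass) * ?h x = ennreal (u_tilde \<alpha> \<rho> x) * indicator A x"
      by (simp add: mult.assoc)
  qed
  finally show ?thesis .
qed

end

theorem theorem4p1:
  fixes M :: "'a measure" and X :: "real \<Rightarrow> 'a \<Rightarrow> real" and \<alpha> \<rho> :: real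
  assumes "1 < \<alpha>" "\<alpha> < 2" "0 < \<rho>" "\<rho> < 1"
    and "0 < \<alpha> * \<rho>" "\<alpha> * \<rho> < 1"
    and "0 < \<alpha> * (1 - \<rho>)" "\<alpha> * (1 - \<rho>) < 1"
    and "levy_process M X"
    and "has_char_exponent M X (Psi_tilde \<alpha> \<rho>)"
  shows "(\<forall>A\<in>sets borel. potential M X A = (\<integral>\<^sup>+ x\<in>A. ennreal (u_tilde \<alpha> \<rho> x) \<partial>lborel))
         \<and> isCont (u_tilde \<alpha> \<rho>) 0"
proof -
  interpret censored_stable_process \<alpha> \<rho> M X
    using assms by unfold_locales auto
  show ?thesis
    using potential_eq isCont_u_tilde_0 by blast
qed

end
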